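(* Let $G\ge 1$ and consider $G$ classical clockworks $C_1,\dots,C_G$ of dimension two together with a feedback policy $\Pi=(\mathcal{M},\upsilon,\gamma)$ such that for every $a=1,\dots,G$ the parameter space is $\mathcal{G}^{a}=\tilde{\mathcal{G}}^{a}\times\tilde{\mathcal{G}}^{a}$ for some $\{0\}\neq\tilde{\mathcal{G}}^{a}\subset\mathbb{R}_{\ge 0}$. Let the joint system (clockworks and memory) be initialized in a steady state. Then, for any integrated current $N(t)$, the asymptotic signal-to-noise ratio $\mathfrak{S}$ of $N(t)$ satisfies $$\mathfrak{S}\;\le\;\max_{m\in\mathcal{M}}\Bigl(\max_{(i_1,\dots,i_G)\in\{0,1\}^G}\ \sum_{a=1}^{G}\gamma^{(a)}_{i_a}(m)\Bigr).$$
   Context: Classical clockwork of dimension two. Clockwork $C_a$ has two states $0,1$ and remains diagonal in a fixed orthonormal basis $\{|0\rangle,|1\rangle\}$ at all times. Its dynamics is given by a trivial Hamiltonian and jump operators $J_{C_a,0}=\sqrt{\Gamma^{(a)}_0}\,|1\rangle\langle 0|$ and $J_{C_a,1}=\sqrt{\Gamma^{(a)}_1}\,|0\rangle\langle 1|$. That is, it jumps from state $i$ to state $i\oplus 1$ (addition modulo two) at rate $\Gamma^{(a)}_i$. A jump of clockwork $C_a$ out of state $i$ is called a jump of type $(a,i)$, and $\mathcal{J}_a=\{(a,0),(a,1)\}$ is the set of jump types of $C_a$. The control parameters of $C_a$ are the pair of rates $(\Gamma^{(a)}_0,\Gamma^{(a)}_1)$, ranging over the parameter space $\mathcal{G}^a$.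 Feedback policy. A feedback policy $\Pi=(\mathcal{M},\upsilon,\gamma)$ consists of - a finite (non-empty) set $\mathcal{M}$ of memory states, - a memory-update function $\upsilon:\mathcal{M}\times\bigcup_{a=1}^G\mathcal{J}_a\to\mathcal{M}$, and - parameter-update functions $\gamma=\{\gamma^{(a)}\}_{a=1}^G$ with $\gamma^{(a)}:\mathcal{M}\to\mathcal{G}^a$. We write $\gamma^{(a)}(m)=(\gamma^{(a)}_0(m),\gamma^{(a)}_1(m))$. When the memory is in state $m$, clockwork $C_a$ is operated with rates $\Gamma^{(a)}_i=\gamma^{(a)}_i(m)$. When a jump of type $(a,i)$ occurs, the memory is immediately updated from $m$ to $\upsilon(m,(a,i))$. Joint dynamics. The joint system of clockworks and memory is a continuous-time Markov chain on $\{0,1\}^G\times\mathcal{M}$. From state $(x,m)$ with $x=(x^{(1)},\dots,x^{(G)})$, for each $a$, it jumps at rate $\gamma^{(a)}_{x^{(a)}}(m)$ to $(x\oplus\mathbb{1}^{(a)},\,\upsilon(m,(a,x^{(a)})))$, where $\mathbb{1}^{(a)}$ is the $a$-th unit vector and $\oplus$ is entrywise addition modulo two. A steady state is a stationary distribution of this chain. Integrated current. An integrated current is a random variable $$N(t)=\sum_{a=1}^G\sum_{i\in\{0,1\}}\sum_{m\in\mathcal{M}} w^{(a)}_{i,m}N^{(a)}_{i,m}(t)$$ with real weights $w^{(a)}_{i,m}$, where $N^{(a)}_{i,m}(t)$ counts the jumps of type $(a,i)$ occurring up to time $t$ while the memory was in state $m$ immediately before the jump. Signal-to-noise ratio. $\mathfrak{S}=\lim_{t\to\infty}\mathfrak{S}(t)$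 with $$\mathfrak{S}(t)=\frac{\bigl(\frac{d}{dt}\mathbb{E}_t[N]\bigr)^2}{\mathrm{Var}_t[N]/t},$$ where $\mathbb{E}_t[N]$ and $\mathrm{Var}_t[N]$ are the mean and variance of $N(t)$; the degenerate quotient $0/0$ is read as $0$. *)

theory Defs
  imports "HOL-Probability.Probability"
begin

subsection \<open>Continuous-time Markov chains on a finite state space\<close>

text \<open>\<open>r s s'\<close> is the rate of jumping from \<open>s\<close> to \<open>s'\<close>.  The diagonal of the generator is minus the
  total escape rate, so that all rows sum to zero; a diagonal entry \<open>r s s\<close> has no effect.\<close>

definition generator :: "('s::finite \<Rightarrow> 's \<Rightarrow> real) \<Rightarrow> 's \<Rightarrow> 's \<Rightarrow> real" where
  "generator r s s' = r s s' - (if s = s' then (\<Sum>u\<in>UNIV. r s u) else 0)"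

text \<open>The Kolmogorov forward equation with initial value the identity matrix: for \<open>t \<ge> 0\<close> it
  determines \<open>P t\<close> uniquely as the exponential of \<open>t\<close> times the generator.\<close>

definition transition_function ::
  "('s::finite \<Rightarrow> 's \<Rightarrow> real) \<Rightarrow> (real \<Rightarrow> 's \<Rightarrow> 's \<Rightarrow> real) \<Rightarrow> bool" where
  "transition_function r P \<longleftrightarrow>
     (\<forall>s s'. P 0 s s' = of_bool (s = s')) \<and>
     (\<forall>t\<ge>0. \<forall>s s'. ((\<lambda>\<tau>. P \<tau> s s') has_real_derivative
        (\<Sum>u\<in>UNIV. P t s u * generator r u s')) (at t within {0..}))"

definition stationary :: "('s::finite \<Rightarrow> 's \<Rightarrow> real) \<Rightarrow> 's pmf \<Rightarrow> bool" where
  "stationary r p \<longleftrightarrow> (\<forall>s'. (\<Sum>s\<in>UNIV. pmf p s * generator r s s') = 0)"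

text \<open>A chain with jump rates \<open>r\<close> and initial distribution \<open>p\<close>, on any probability space.  The paths
  are right-continuous with left limits for the discrete topology on the state space, hence piecewise
  constant with finitely many jumps in every bounded time interval.  The finite-dimensional
  distributions are those of the Markov chain generated by \<open>r\<close>.\<close>

locale markov_jump_process = prob_space M
  for M :: "'w measure"
    and r :: "'s::finite \<Rightarrow> 's \<Rightarrow> real"
    and p :: "'s pmf"
    and X :: "real \<Rightarrow> 'w \<Rightarrow> 's" +
  assumes measurable_state: "0 \<le> t \<Longrightarrow> X t \<in> measurable M (count_space UNIV)"
    and right_continuous:
      "\<omega> \<in> space M \<Longrightarrow> 0 \<le> t \<Longrightarrow> \<forall>\<^sub>F u in at_right t. X u \<omega> = X t \<omega>"
    and left_limits:
      "\<omega> \<in> space M \<Longrightarrow> 0 < t \<Longrightarrow> \<exists>s. \<forall>\<^sub>F u in at_left t. X u \<omega> = s"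
    and finite_dim_distr:
      "\<exists>P. transition_function r P \<and>
        (\<forall>\<tau> s n. \<tau> 0 = 0 \<and> mono \<tau> \<longrightarrow>
           measure M {\<omega> \<in> space M. \<forall>k\<le>n. X (\<tau> k) \<omega> = s k} =
             pmf p (s 0) * (\<Prod>k<n. P (\<tau> (Suc k) - \<tau> k) (s k) (s (Suc k))))"


subsection \<open>Two-dimensional classical clockworks under feedback\<close>

text \<open>Clockworks are indexed by the finite type \<open>'g\<close>, whose cardinality is the number of clockworks;
  memory states are the elements of the finite type \<open>'m\<close>.  The clockwork states 0 and 1 are
  \<^const>\<open>False\<close> and \<^const>\<open>True\<close>, so addition of 1 modulo two is negation.  A jump type is a pair of a
  clockwork and the state which it leaves; the control parameters of a clockwork are its pair of
  rates out of state 0 and out of state 1.\<close>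

record ('g, 'm) feedback_policy =
  mem_update :: "'m \<Rightarrow> 'g \<times> bool \<Rightarrow> 'm"
  par_update :: "'g \<Rightarrow> 'm \<Rightarrow> real \<times> real"

definition clock_rate :: "('g, 'm) feedback_policy \<Rightarrow> 'g \<Rightarrow> bool \<Rightarrow> 'm \<Rightarrow> real" where
  "clock_rate pol a i m = (if i then snd (par_update pol a m) else fst (par_update pol a m))"

definition joint_jump ::
  "('g, 'm) feedback_policy \<Rightarrow> 'g \<Rightarrow> ('g \<Rightarrow> bool) \<times> 'm \<Rightarrow> ('g \<Rightarrow> bool) \<times> 'm" where
  "joint_jump pol a = (\<lambda>(x, m). (x(a := \<not> x a), mem_update pol m (a, x a)))"

definition joint_rate ::
  "('g::finite, 'm::finite) feedback_policy
     \<Rightarrow> ('g \<Rightarrow> bool) \<times> 'm \<Rightarrow> ('g \<Rightarrow> bool) \<times> 'm \<Rightarrow> real" where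
  "joint_rate pol = (\<lambda>(x, m) s'.
     \<Sum>a\<in>UNIV. if s' = joint_jump pol a (x, m) then clock_rate pol a (x a) m else 0)"


subsection \<open>Integrated currents and signal-to-noise ratio\<close>

text \<open>The times in \<open>(0, t]\<close> at which a path \<open>\<xi>\<close> makes a jump of type \<open>(a, i)\<close> with memory state \<open>m\<close>
  immediately before the jump.\<close>

definition jump_times ::
  "('g, 'm) feedback_policy \<Rightarrow> (real \<Rightarrow> ('g \<Rightarrow> bool) \<times> 'm) \<Rightarrow> 'g \<Rightarrow> bool \<Rightarrow> 'm \<Rightarrow> real \<Rightarrow> real set" where
  "jump_times pol \<xi> a i m t =
     {u \<in> {0<..t}. \<exists>x. x a = i \<and> (\<forall>\<^sub>F v in at_left u. \<xi> v = (x, m)) \<and> \<xi> u = joint_jump pol a (x, m)}"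

definition integrated_current ::
  "('g::finite, 'm::finite) feedback_policy \<Rightarrow> (real \<Rightarrow> 'w \<Rightarrow> ('g \<Rightarrow> bool) \<times> 'm)
     \<Rightarrow> ('g \<Rightarrow> bool \<Rightarrow> 'm \<Rightarrow> real) \<Rightarrow> real \<Rightarrow> 'w \<Rightarrow> real" where
  "integrated_current pol X w t \<omega> =
     (\<Sum>a\<in>UNIV. \<Sum>i\<in>UNIV. \<Sum>m\<in>UNIV.
        w a i m * real (card (jump_times pol (\<lambda>u. X u \<omega>) a i m t)))"

text \<open>The quotient is taken in \<^typ>\<open>ereal\<close>, where \<open>0 / 0 = 0\<close> but \<open>c / 0 = \<infinity>\<close> for \<open>c > 0\<close>: a non-zero
  current without fluctuations has infinite signal-to-noise ratio.\<close>

definition snr :: "'w measure \<Rightarrow> (real \<Rightarrow> 'w \<Rightarrow> real) \<Rightarrow> real \<Rightarrow> ereal" where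
  "snr M N t =
     ereal ((deriv (\<lambda>\<tau>. prob_space.expectation M (N \<tau>)) t)\<^sup>2) / ereal (prob_space.variance M (N t) / t)"

definition asymptotic_snr :: "'w measure \<Rightarrow> (real \<Rightarrow> 'w \<Rightarrow> real) \<Rightarrow> ereal" where
  "asymptotic_snr M N = Lim at_top (snr M N)"

end

theory Submission
  imports Defs
begin

text \<open>The bound is the kinetic uncertainty relation: in the steady state the squared mean current is at
  most the variance rate times the mean number of jumps per unit time, which in turn is at most the
  largest total escape rate.

  Observe the chain on a grid of mesh \<open>h = t / k\<close>.  The variables counting 1 for every change of
  state and subtracting the conditional probability \<open>1 - P\<^sub>h(s,s)\<close> of a change are the score of
  rescaling time.  Adding \<open>c\<close> times this score to the weights of the current leaves the mean
  unchanged, and, because \<open>p\<close> is stationary and the score is a martingale difference, changes the limit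
  of the second moment exactly by \<open>t (2 c J + c\<^sup>2 A)\<close>, where \<open>J\<close> is the mean current and \<open>A\<close> the
  activity.  Nonnegativity of the variance at \<open>c = - J / A\<close> is the claim.

  The limit defining the signal-to-noise ratio exists since the variance is
  \<open>\<alpha> t\<^sup>2 + \<beta> t\<close> up to a bounded term.  This follows from the decomposition of functions into a harmonic
  part and an element of the range of the generator, which holds as the semigroup is bounded; the
  chain may well be reducible.\<close>

subsection \<open>The transition semigroup\<close>

text \<open>The squared negative part measures how far a solution is from being nonnegative, and
  squaring smooths the kink: at 0 the difference quotient is bounded by
  \<open>\<bar>h\<bar>\<close>.\<close>

lemma has_real_derivative_min_zero_squared:
  "((\<lambda>x::real. (min x 0)\<^sup>2) has_real_derivative 2 * min x 0) (at x)"
proof -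
  consider "x < 0" | "x = 0" | "x > 0" by linarith
  then show ?thesis
  proof cases
    case 1
    have "((\<lambda>x::real. x\<^sup>2) has_real_derivative 2 * min x 0) (at x)"
      using 1 by (auto intro!: derivative_eq_intros)
    moreover have "\<forall>\<^sub>F y in nhds x. y\<^sup>2 = (min y 0)\<^sup>2"
      using eventually_nhds_in_open[of "{..<0}" x] 1 by (auto elim!: eventually_mono)
    ultimately show ?thesis
      using DERIV_cong_ev[of x x "\<lambda>x. x\<^sup>2" "\<lambda>x. (min x 0)\<^sup>2" "2 * min x 0" "2 * min x 0"] by simp
  next
    case 2
    have "((\<lambda>h::real. (min h 0)\<^sup>2 / h) \<longlongrightarrow> 0) (at 0)"
    proof (rule Lim_null_comparison)
      show "\<forall>\<^sub>F h in at (0::real). norm ((min h 0)\<^sup>2 / h) \<le> \<bar>h\<bar>"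
        by (rule always_eventually) (auto simp: min_def power2_eq_square)
      show "((\<lambda>h::real. \<bar>h\<bar>) \<longlongrightarrow> 0) (at 0)"
        by (rule tendsto_eq_intros | simp)+
    qed
    then show ?thesis using 2 by (simp add: has_field_derivative_iff)
  next
    case 3
    have "((\<lambda>x::real. 0) has_real_derivative 2 * min x 0) (at x)"
      using 3 by (auto intro!: derivative_eq_intros)
    moreover have "\<forall>\<^sub>F y in nhds x. 0 = (min y 0)\<^sup>2"
      using eventually_nhds_in_open[of "{0<..}" x] 3 by (auto elim!: eventually_mono)
    ultimately show ?thesis
      using DERIV_cong_ev[of x x "\<lambda>x. 0" "\<lambda>x. (min x 0)\<^sup>2" "2 * min x 0" "2 * min x 0"] by simp
  qed
qed

text \<open>With the integrating factor \<open>exp (- C * x)\<close> the function \<open>E\<close>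
  becomes nonincreasing, and it starts at a value at most 0.\<close>

lemma gronwall_zero:
  fixes E E' :: "real \<Rightarrow> real"
  assumes deriv: "\<And>t. t \<ge> 0 \<Longrightarrow> (E has_real_derivative E' t) (at t within {0..})"
    and bound: "\<And>t. t \<ge> 0 \<Longrightarrow> E' t \<le> C * E t"
    and "E 0 \<le> 0" and "t \<ge> 0"
  shows "E t \<le> 0"
proof (cases "t = 0")
  case False
  then have "t > 0" using \<open>t \<ge> 0\<close> by simp
  define H where "H x = exp (- C * x) * E x" for x
  have dH: "(H has_real_derivative exp (- C * x) * (E' x - C * E x)) (at x within {0..})" if "x \<ge> 0" for x
    unfolding H_def by (rule derivative_eq_intros deriv that | simp add: algebra_simps)+
  have "H t \<le> H 0"
  proof (rule DERIV_nonpos_imp_decreasing_open[of 0 t H])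
    show "0 \<le> t" using assms by simp
    fix x :: real assume x: "0 < x" "x < t"
    have "(H has_real_derivative exp (- C * x) * (E' x - C * E x)) (at x)"
      using dH[of x] x at_within_interior[of x "{0..}"] by simp
    moreover have "exp (- C * x) * (E' x - C * E x) \<le> 0"
      using bound[of x] x by (simp add: mult_nonneg_nonpos)
    ultimately show "\<exists>y. DERIV H x :> y \<and> y \<le> 0" by blast
  next
    have "continuous_on {0..} H"
      by (rule DERIV_continuous_on, rule dH) simp
    then show "continuous_on {0..t} H" by (rule continuous_on_subset) auto
  qed
  then have "exp (- C * t) * E t \<le> 0" using assms by (simp add: H_def)
  then show ?thesis by (simp add: mult_le_0_iff)
qed (use assms in simp)

lemma generator_offdiag: "s \<noteq> s' \<Longrightarrow> generator r s s' = r s s'"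
  by (simp add: generator_def)

lemma sum_generator: "(\<Sum>s'\<in>UNIV. generator r s s') = 0"
  by (simp add: generator_def sum_subtractf)

text \<open>An energy estimate: \<open>E\<close> is the squared Euclidean norm of the negative part
  of the solution. Its derivative is at most \<open>2 * D * E\<close>, and it vanishes at time 0, so
  it stays zero by Gronwall.\<close>

lemma forward_equation_nonneg:
  fixes r :: "'s::finite \<Rightarrow> 's \<Rightarrow> real" and v :: "real \<Rightarrow> 's \<Rightarrow> real"
  assumes r: "\<And>s s'. r s s' \<ge> 0"
    and deriv: "\<And>t s. t \<ge> 0 \<Longrightarrow> ((\<lambda>\<tau>. v \<tau> s) has_real_derivative
                  (\<Sum>u\<in>UNIV. v t u * generator r u s)) (at t within {0..})"
    and init: "\<And>s. v 0 s \<ge> 0" and t: "t \<ge> 0"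
  shows "v t s \<ge> 0"
proof -
  define n where "n \<tau> s = min (v \<tau> s) 0" for \<tau> s
  define E where "E \<tau> = (\<Sum>s\<in>UNIV. (n \<tau> s)\<^sup>2)" for \<tau>
  define D where "D = (\<Sum>s\<in>UNIV. \<Sum>u\<in>UNIV. \<bar>generator r u s\<bar>)"
  define E' where "E' \<tau> = (\<Sum>s\<in>UNIV. 2 * n \<tau> s * (\<Sum>u\<in>UNIV. v \<tau> u * generator r u s))" for \<tau>
  have "E t \<le> 0"
  proof (rule gronwall_zero[of E E' "2 * D"])
    fix x :: real assume x: "x \<ge> 0"
    show "(E has_real_derivative E' x) (at x within {0..})"
      unfolding E_def[abs_def] E'_def n_def
      by (rule DERIV_sum, rule DERIV_chain2[OF has_real_derivative_min_zero_squared deriv[OF x]])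
    have sq: "(n x s)\<^sup>2 \<le> E x" for s
      unfolding E_def by (rule member_le_sum) auto
    have "n x s * (v x u * generator r u s) \<le> \<bar>generator r u s\<bar> * E x" for s u
    proof -
      \<comment> \<open>The diagonal entry of the generator may be negative, but there
        \<open>n * v = n * n\<close> holds exactly. Off the diagonal the entry is a rate, hence
        nonnegative, and replacing \<open>v\<close> by the smaller \<open>n\<close> increases the
        product with \<open>n x s \<le> 0\<close>.\<close>
      have "n x s * v x u * generator r u s \<le> n x s * n x u * generator r u s"
      proof (cases "u = s")
        case True
        then have "n x s * v x u = n x s * n x u" by (auto simp: n_def min_def)
        then have "n x s * v x u * generator r u s = n x s * n x u * generator r u s"
          by (rule arg_cong)
        then show ?thesis by (rule eq_refl)
      next
        case False
        have "n x s * v x u \<le> n x s * n x u"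
          by (rule mult_left_mono_neg) (auto simp: n_def)
        then show ?thesis using r[of u s] False by (simp add: generator_offdiag mult_right_mono)
      qed
      also have "\<dots> \<le> \<bar>n x s * n x u\<bar> * \<bar>generator r u s\<bar>"
        by (metis abs_ge_self abs_mult)
      also have "\<dots> \<le> E x * \<bar>generator r u s\<bar>"
      proof (rule mult_right_mono)
        have "0 \<le> (\<bar>n x s\<bar> - \<bar>n x u\<bar>)\<^sup>2" by simp
        then have "2 * \<bar>n x s * n x u\<bar> \<le> (n x s)\<^sup>2 + (n x u)\<^sup>2"
          by (simp add: power2_diff abs_mult)
        then show "\<bar>n x s * n x u\<bar> \<le> E x" using sq[of s] sq[of u] by linarith
      qed simp
      finally show ?thesis by (simp add: mult_ac)
    qed
    then have "(\<Sum>s\<in>UNIV. \<Sum>u\<in>UNIV. n x s * (v x u * generator r u s))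
        \<le> (\<Sum>s\<in>UNIV. \<Sum>u\<in>UNIV. \<bar>generator r u s\<bar> * E x)"
      by (intro sum_mono)
    then have "2 * (\<Sum>s\<in>UNIV. \<Sum>u\<in>UNIV. n x s * (v x u * generator r u s)) \<le> 2 * (D * E x)"
      by (simp add: D_def sum_distrib_right)
    then show "E' x \<le> 2 * D * E x"
      by (simp add: E'_def sum_distrib_left mult_ac)
  next
    show "E 0 \<le> 0" using init by (simp add: E_def n_def)
  qed (fact t)
  moreover have "(n t s)\<^sup>2 \<le> E t"
    unfolding E_def by (rule member_le_sum) auto
  ultimately have "(n t s)\<^sup>2 \<le> 0" by linarith
  then show ?thesis by (simp add: n_def min_def split: if_splits)
qed

text \<open>The equation is linear, so both differences of the two solutions solve it with initial
  value 0, and both are nonnegative.\<close>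

lemma forward_equation_unique:
  fixes r :: "'s::finite \<Rightarrow> 's \<Rightarrow> real" and v w :: "real \<Rightarrow> 's \<Rightarrow> real"
  assumes r: "\<And>s s'. r s s' \<ge> 0"
    and v: "\<And>t s. t \<ge> 0 \<Longrightarrow> ((\<lambda>\<tau>. v \<tau> s) has_real_derivative
                  (\<Sum>u\<in>UNIV. v t u * generator r u s)) (at t within {0..})"
    and w: "\<And>t s. t \<ge> 0 \<Longrightarrow> ((\<lambda>\<tau>. w \<tau> s) has_real_derivative
                  (\<Sum>u\<in>UNIV. w t u * generator r u s)) (at t within {0..})"
    and init: "\<And>s. v 0 s = w 0 s" and t: "t \<ge> 0"
  shows "v t s = w t s"
proof -
  have "0 \<le> v t s - w t s"
    by (rule forward_equation_nonneg[OF r, of "\<lambda>t s. v t s - w t s"])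
       (use init t in \<open>auto intro!: derivative_eq_intros v w
          simp: sum_subtractf left_diff_distrib\<close>)
  moreover have "0 \<le> w t s - v t s"
    by (rule forward_equation_nonneg[OF r, of "\<lambda>t s. w t s - v t s"])
       (use init t in \<open>auto intro!: derivative_eq_intros v w
          simp: sum_subtractf left_diff_distrib\<close>)
  ultimately show ?thesis by simp
qed

text \<open>A matrix acting on a function of the state: \<open>app (generator r)\<close> is the
  generator L acting on observables, and \<open>app (P t) f s\<close> is the mean of
  \<open>f\<close> at time \<open>t\<close> for the chain started in \<open>s\<close>.\<close>

definition app :: "('s::finite \<Rightarrow> 's \<Rightarrow> real) \<Rightarrow> ('s \<Rightarrow> real) \<Rightarrow> 's \<Rightarrow> real" where
  "app A f s = (\<Sum>u\<in>UNIV. A s u * f u)"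

section \<open>Transition probabilities and their action on observables\<close>

locale transition =
  fixes r :: "'s::finite \<Rightarrow> 's \<Rightarrow> real" and P :: "real \<Rightarrow> 's \<Rightarrow> 's \<Rightarrow> real"
  assumes rate_nonneg: "r s s' \<ge> 0"
    and transition_function: "transition_function r P"
begin

lemma P_0: "P 0 s s' = of_bool (s = s')"
  using transition_function by (simp add: transition_function_def)

lemma P_deriv:
  "t \<ge> 0 \<Longrightarrow> ((\<lambda>\<tau>. P \<tau> s s') has_real_derivative (\<Sum>u\<in>UNIV. P t s u * generator r u s')) (at t within {0..})"
  using transition_function by (simp add: transition_function_def)

lemma P_nonneg: "t \<ge> 0 \<Longrightarrow> P t s s' \<ge> 0"
  by (rule forward_equation_nonneg[of r "\<lambda>t. P t s"]) (auto simp: rate_nonneg P_0 P_deriv)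

lemma app_P_deriv:
  assumes "t \<ge> 0"
  shows "((\<lambda>\<tau>. app (P \<tau>) f s) has_real_derivative app (P t) (app (generator r) f) s) (at t within {0..})"
proof -
  have "((\<lambda>\<tau>. app (P \<tau>) f s) has_real_derivative
      (\<Sum>u\<in>UNIV. (\<Sum>v\<in>UNIV. P t s v * generator r v u) * f u)) (at t within {0..})"
    unfolding app_def by (intro DERIV_sum DERIV_cmult_right P_deriv assms)
  also have "(\<Sum>u\<in>UNIV. (\<Sum>v\<in>UNIV. P t s v * generator r v u) * f u)
      = (\<Sum>u\<in>UNIV. (\<Sum>v\<in>UNIV. P t s v * generator r v u * f u))"
    by (simp add: sum_distrib_right)
  also have "\<dots> = app (P t) (app (generator r) f) s"
    unfolding app_def by (subst sum.swap) (simp add: sum_distrib_left mult_ac)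
  finally show ?thesis .
qed

lemma app_P_0 [simp]: "app (P 0) f = f"
  by (simp add: app_def P_0 fun_eq_iff)

text \<open>The derivative of \<open>app (P t) f\<close> is \<open>app (P t) (L f)\<close>. Since L
  annihilates \<open>L f\<close>, this is constant in time and equal to its value \<open>L f\<close>
  at time 0.\<close>

lemma app_P_affine:
  assumes "app (generator r) (app (generator r) f) = (\<lambda>_. 0)" and t: "t \<ge> 0"
  shows "app (P t) f s = f s + t * app (generator r) f s"
proof -
  have const: "app (P x) g s = g s" if g: "app (generator r) g = (\<lambda>_. 0)" and "x \<ge> 0" for g x
  proof -
    have "\<exists>c. \<forall>x\<in>{0..}. app (P x) g s = c"
      by (rule has_field_derivative_zero_constant)
         (use app_P_deriv[of _ g s] g in \<open>auto simp: app_def\<close>)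
    then obtain c where "\<And>x. x \<ge> 0 \<Longrightarrow> app (P x) g s = c" by auto
    from this[of x] this[of 0] show ?thesis using that by simp
  qed
  have "\<exists>c. \<forall>x\<in>{0..}. app (P x) f s - x * app (generator r) f s = c"
    by (rule has_field_derivative_zero_constant)
       (auto intro!: derivative_eq_intros app_P_deriv simp: const[OF assms(1)])
  then obtain c where "\<And>x. x \<ge> 0 \<Longrightarrow> app (P x) f s - x * app (generator r) f s = c" by auto
  from this[of t] this[of 0] show ?thesis using t by simp
qed

lemma app_P_harmonic:
  assumes "app (generator r) f = (\<lambda>_. 0)" and "t \<ge> 0"
  shows "app (P t) f = f"
proof
  have "app (generator r) (app (generator r) f) = (\<lambda>_. 0)"
    by (simp only: assms(1)) (simp add: app_def fun_eq_iff)
  then show "app (P t) f s = f s" for s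
    using app_P_affine[of f t s] assms by simp
qed

text \<open>Constants are harmonic because the rows of the generator sum to zero.\<close>

lemma P_row_sum: "t \<ge> 0 \<Longrightarrow> (\<Sum>s'\<in>UNIV. P t s s') = 1"
  using fun_cong[OF app_P_harmonic[of "\<lambda>_. 1" t], of s] by (simp add: app_def sum_generator fun_eq_iff)

lemma P_le_1:
  assumes "t \<ge> 0" shows "P t s s' \<le> 1"
proof -
  have "P t s s' \<le> (\<Sum>s'\<in>UNIV. P t s s')"
    by (rule member_le_sum) (auto simp: P_nonneg assms)
  then show ?thesis by (simp add: P_row_sum assms)
qed

lemma abs_app_P_le:
  assumes "t \<ge> 0" shows "\<bar>app (P t) f s\<bar> \<le> (\<Sum>u\<in>UNIV. \<bar>f u\<bar>)"
proof -
  have "\<bar>app (P t) f s\<bar> \<le> (\<Sum>u\<in>UNIV. \<bar>P t s u * f u\<bar>)" unfolding app_def by (rule sum_abs)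
  also have "\<dots> \<le> (\<Sum>u\<in>UNIV. \<bar>f u\<bar>)"
    using assms by (intro sum_mono) (simp add: abs_mult P_nonneg P_le_1 mult_left_le_one_le)
  finally show ?thesis .
qed

text \<open>If \<open>L (L f) = 0\<close> then \<open>P\<^sub>t f = f + t L f\<close>, which is bounded in \<open>t\<close> only for \<open>L f = 0\<close>.\<close>

lemma generator_square_kernel:
  assumes "app (generator r) (app (generator r) f) = (\<lambda>_. 0)"
  shows "app (generator r) f = (\<lambda>_. 0)"
proof
  fix s
  define C where "C = (\<Sum>u\<in>UNIV. \<bar>f u\<bar>)"
  show "app (generator r) f s = 0"
  proof (rule ccontr)
    assume nz: "app (generator r) f s \<noteq> 0"
    \<comment> \<open>At this time \<open>\<bar>t * L f s\<bar> = 2 * C + 1\<close>, whereas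
      \<open>f s\<close> and \<open>f s + t * L f s\<close> are both bounded by \<open>C\<close>, so
      their difference is at most \<open>2 * C\<close>.\<close>
    define t where "t = (2 * C + 1) / \<bar>app (generator r) f s\<bar>"
    have "C \<ge> 0" by (simp add: C_def sum_nonneg)
    then have "t \<ge> 0" by (simp add: t_def)
    have "\<bar>f s\<bar> \<le> C" unfolding C_def by (rule member_le_sum) auto
    moreover have "\<bar>f s + t * app (generator r) f s\<bar> \<le> C"
      using abs_app_P_le[OF \<open>t \<ge> 0\<close>, of f s] app_P_affine[OF assms \<open>t \<ge> 0\<close>, of s] by (simp add: C_def)
    moreover have "\<bar>t * app (generator r) f s\<bar> = 2 * C + 1"
      using nz \<open>C \<ge> 0\<close> by (simp add: t_def abs_mult)
    ultimately show False by linarith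
  qed
qed

text \<open>Since \<open>L (L f) = 0\<close> forces \<open>L f = 0\<close>, the generator is
  injective on its range and, by finite dimension, maps the range onto itself. Hence
  \<open>L f = L (L z)\<close> for some \<open>z\<close>, and \<open>f - L z\<close> is
  harmonic.\<close>

lemma harmonic_decomposition:
  obtains f0 g where "app (generator r) f0 = (\<lambda>_. 0)" and "\<And>s. f s = f0 s + app (generator r) g s"
proof -
  define T :: "real ^ 's \<Rightarrow> real ^ 's" where "T x = (\<chi> s. app (generator r) (($) x) s)" for x
  have lin: "linear T"
    by (rule linearI) (auto simp: T_def app_def vec_eq_iff algebra_simps sum.distrib sum_distrib_left)
  have ker: "T x = 0" if "T (T x) = 0" for x
  proof -
    have "($) (T x) = app (generator r) (($) x)"
      by (simp add: T_def fun_eq_iff)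
    moreover have "app (generator r) (($) (T x)) = (\<lambda>_. 0)"
      using that by (simp add: T_def[of "T x"] vec_eq_iff fun_eq_iff)
    ultimately have "app (generator r) (app (generator r) (($) x)) = (\<lambda>_. 0)"
      by simp
    from generator_square_kernel[OF this] show ?thesis by (simp add: T_def vec_eq_iff)
  qed
  have "inj_on T (range T)"
  proof (rule inj_onI)
    fix x y assume "x \<in> range T" "y \<in> range T" "T x = T y"
    then obtain a b where ab: "x = T a" "y = T b" by auto
    have "T (T (a - b)) = 0" using ab \<open>T x = T y\<close> by (simp add: linear_diff[OF lin])
    then have "T (a - b) = 0" by (rule ker)
    then show "x = y" using ab by (simp add: linear_diff[OF lin])
  qed
  moreover have sub: "subspace (range T)" by (rule linear_subspace_image[OF lin subspace_UNIV])
  ultimately have "dim (T ` range T) = dim (range T)"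
    by (intro dim_image_eq[OF lin]) (metis span_eq_iff)
  then have "T ` range T = range T"
    by (intro subspace_dim_equal linear_subspace_image[OF lin] sub) auto
  then obtain z where z: "T (\<chi> s. f s) = T (T z)" by (metis (no_types, lifting) imageE rangeI)
  define g where "g = ($) z"
  define f0 where "f0 s = f s - app (generator r) g s" for s
  have "app (generator r) f0 s = 0" for s
    using arg_cong[OF z, of "\<lambda>v. v $ s"]
    by (simp add: T_def app_def f0_def g_def right_diff_distrib sum_subtractf)
  then show ?thesis by (intro that[of f0 g]) (auto simp: f0_def)
qed

text \<open>Each decomposition yields one explicit time integral: for \<open>f = f0 + L g\<close>,
  the function \<open>x * f0 + app (P x) g\<close> has derivative \<open>app (P x) f\<close>. The
  double integral in the second moment takes two of them.\<close>

lemma harmonic_decomposition_twice: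
  obtains f0 g g0 h where "app (generator r) f0 = (\<lambda>_. 0)" "\<And>s. f s = f0 s + app (generator r) g s"
    and "app (generator r) g0 = (\<lambda>_. 0)" "\<And>s. g s = g0 s + app (generator r) h s"
  using harmonic_decomposition[where f = f] harmonic_decomposition by metis

end

subsection \<open>Riemann sums along the semigroup\<close>

text \<open>On each cell the mean value theorem turns the increment of \<open>F\<close> into a value
  of \<open>f\<close>, and uniform continuity of \<open>f\<close> compares that with the value at
  the left endpoint.\<close>

lemma riemann_sum_tendsto:
  fixes F f :: "real \<Rightarrow> real"
  assumes t: "t > 0"
    and deriv: "\<And>x. x \<ge> 0 \<Longrightarrow> (F has_real_derivative f x) (at x within {0..})"
    and cont: "continuous_on {0..} f"
  shows "(\<lambda>k. t / real k * (\<Sum>j<k. f (t * real j / real k))) \<longlonglongrightarrow> F t - F 0"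
proof (rule LIMSEQ_I)
  fix e :: real assume "e > 0"
  define e' where "e' = e / (2 * t)"
  have "e' > 0" using \<open>e > 0\<close> t by (simp add: e'_def)
  have "uniformly_continuous_on {0..t} f"
    by (rule compact_uniformly_continuous[OF continuous_on_subset[OF cont]]) auto
  then obtain d where "d > 0" and d: "\<And>x y. x \<in> {0..t} \<Longrightarrow> y \<in> {0..t} \<Longrightarrow> \<bar>y - x\<bar> < d \<Longrightarrow> \<bar>f y - f x\<bar> < e'"
    using \<open>e' > 0\<close> unfolding uniformly_continuous_on_def dist_real_def by metis
  obtain K :: nat where K: "K > 0" "t / d < real K"
    by (metis gr0I less_numeral_extra(3) not_less_iff_gr_or_eq of_nat_0 divide_pos_pos \<open>d > 0\<close> t reals_Archimedean2)
  have "norm (t / real k * (\<Sum>j<k. f (t * real j / real k)) - (F t - F 0)) < e" if "k \<ge> K" for k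
  proof -
    have k: "k > 0" using that K by simp
    have "t / d < real k" using K that by linarith
    then have hd: "t / real k < d" using k \<open>d > 0\<close> by (simp add: field_simps)
    define x where "x j = t * real j / real k" for j
    have step: "x (Suc j) - x j = t / real k" for j by (simp add: x_def algebra_simps add_divide_distrib)
    have cell: "\<bar>t / real k * f (x j) - (F (x (Suc j)) - F (x j))\<bar> \<le> t / real k * e'" if "j < k" for j
    proof -
      have lt: "x j < x (Suc j)" using step[of j] divide_pos_pos[of t "real k"] t k by linarith
      have x0: "0 \<le> x j" using t by (simp add: x_def)
      have "t * real (Suc j) \<le> t * real k" using t that by (intro mult_left_mono) auto
      then have xt: "x (Suc j) \<le> t" using k by (simp add: x_def divide_le_eq)
      have at: "(F has_real_derivative f y) (at y)" if "x j < y" for y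
        using deriv[of y] that x0 at_within_interior[of y "{0..}"] by simp
      have "continuous_on {x j..x (Suc j)} F"
        by (rule continuous_on_subset[of "{0..}"], rule DERIV_continuous_on, rule deriv) (use x0 in auto)
      then obtain l z where lz: "x j < z" "z < x (Suc j)" "(F has_real_derivative l) (at z)"
        "F (x (Suc j)) - F (x j) = (x (Suc j) - x j) * l"
        using MVT[OF lt, of F] at by (meson real_differentiable_def)
      have z: "x j < z" "z < x (Suc j)" "F (x (Suc j)) - F (x j) = t / real k * f z"
        using lz DERIV_unique[OF lz(3) at[OF lz(1)]] step[of j] by auto
      have "\<bar>f (x j) - f z\<bar> < e'"
        using d[of z "x j"] z x0 xt step[of j] hd by auto
      have "t / real k * f (x j) - (F (x (Suc j)) - F (x j)) = t / real k * (f (x j) - f z)"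
        unfolding z by (simp add: algebra_simps)
      then show ?thesis using \<open>\<bar>f (x j) - f z\<bar> < e'\<close> t k
        by (simp add: abs_mult divide_right_mono mult_left_mono)
    qed
    have tel: "(\<Sum>j<k. F (x (Suc j)) - F (x j)) = F t - F 0"
      using k by (subst sum_lessThan_telescope) (simp add: x_def)
    have "\<bar>t / real k * (\<Sum>j<k. f (x j)) - (F t - F 0)\<bar>
        = \<bar>\<Sum>j<k. t / real k * f (x j) - (F (x (Suc j)) - F (x j))\<bar>"
      by (simp only: tel[symmetric] sum_distrib_left sum_subtractf)
    also have "\<dots> \<le> (\<Sum>j<k. t / real k * e')"
      by (rule order_trans[OF sum_abs sum_mono]) (use cell in auto)
    also have "\<dots> = t * e'" using k by simp
    also have "\<dots> < e" using t \<open>e > 0\<close> by (simp add: e'_def)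
    finally show ?thesis by (simp add: x_def)
  qed
  then show "\<exists>no. \<forall>n\<ge>no. norm (t / real n * (\<Sum>j<n. f (t * real j / real n)) - (F t - F 0)) < e"
    by blast
qed

section \<open>Averages over pairs of grid cells\<close>

text \<open>The index \<open>i\<close> occurs once for every \<open>j\<close> with
  \<open>i < j < k\<close>, that is, \<open>k - 1 - i\<close> times.\<close>

lemma sum_sum_lessThan:
  "(\<Sum>j<k. \<Sum>i<j. c i :: real) = (\<Sum>i<k. (real k - 1 - real i) * c i)"
proof (induction k)
  case (Suc k)
  have "(\<Sum>i<Suc k. (real (Suc k) - 1 - real i) * c i) = (\<Sum>i<k. (real k - 1 - real i) * c i + c i)"
    by (simp add: algebra_simps)
  then show ?case using Suc by (simp add: sum.distrib)
qed simp

text \<open>The sum is over pairs of distinct cells, with \<open>c\<close> evaluated at their lag.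
  For \<open>c i = \<phi> (t * i / k)\<close> it discretises the integral of
  \<open>(t - x) * \<phi> x\<close> over [0, t], divided by the square of \<open>t\<close>.\<close>

definition mean_pairs :: "nat \<Rightarrow> (nat \<Rightarrow> real) \<Rightarrow> real" where
  "mean_pairs k c = (\<Sum>j<k. \<Sum>i<j. c i) / (real k)\<^sup>2"

text \<open>There are at most \<open>k * k\<close> pairs, so the normalisation absorbs a uniform
  error without a further constant.\<close>

lemma mean_pairs_diff_le:
  assumes "\<And>i. \<bar>c i - d i\<bar> \<le> e"
  shows "\<bar>mean_pairs k c - mean_pairs k d\<bar> \<le> e"
proof (cases "k = 0")
  case False
  have "e \<ge> 0" using assms[of 0] by linarith
  have "\<bar>(\<Sum>j<k. \<Sum>i<j. c i - d i)\<bar> \<le> (\<Sum>j<k. \<Sum>i<j. e)"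
    by (rule order_trans[OF sum_abs sum_mono], rule order_trans[OF sum_abs sum_mono]) (rule assms)
  also have "\<dots> \<le> (\<Sum>j<k. real k * e)"
    using \<open>e \<ge> 0\<close> by (intro sum_mono) (auto intro!: mult_right_mono)
  also have "\<dots> = (real k)\<^sup>2 * e" by (simp add: power2_eq_square)
  finally have "\<bar>(\<Sum>j<k. \<Sum>i<j. c i) - (\<Sum>j<k. \<Sum>i<j. d i)\<bar> \<le> (real k)\<^sup>2 * e"
    by (simp add: sum_subtractf)
  then show ?thesis using False
    by (simp add: mean_pairs_def diff_divide_distrib[symmetric] abs_divide divide_le_eq mult.commute)
qed (use assms[of 0] in \<open>simp add: mean_pairs_def\<close>)

abbreviation pair :: "('s::finite \<Rightarrow> real) \<Rightarrow> ('s \<Rightarrow> real) \<Rightarrow> real" where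
  "pair a f \<equiv> \<Sum>s\<in>UNIV. a s * f s"

context transition
begin

lemma pair_P_deriv:
  assumes "x \<ge> 0"
  shows "((\<lambda>x. pair a (app (P x) f)) has_real_derivative pair a (app (P x) (app (generator r) f)))
    (at x within {0..})"
  by (intro DERIV_sum DERIV_cmult app_P_deriv assms)

lemma continuous_on_pair_P: "continuous_on {0..} (\<lambda>x. pair a (app (P x) f))"
  by (rule DERIV_continuous_on, rule pair_P_deriv) simp

text \<open>With \<open>\<phi> x = pair a (app (P x) f)\<close>, the two decompositions give an
  antiderivative \<open>F1\<close> of \<open>\<phi>\<close> and an antiderivative \<open>F3\<close>
  of \<open>F1\<close> in closed form. The limiting integral is then evaluated by parts, leaving a
  quadratic term, a linear term and a term bounded in \<open>t\<close>.\<close>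

lemma mean_pairs_const_tendsto:
  assumes t: "t > 0"
    and f0: "app (generator r) f0 = (\<lambda>_. 0)" and f: "\<And>s. f s = f0 s + app (generator r) g s"
    and g0: "app (generator r) g0 = (\<lambda>_. 0)" and g: "\<And>s. g s = g0 s + app (generator r) h s"
  shows "(\<lambda>k. mean_pairs k (\<lambda>i. pair a (app (P (t * real i / real k)) f)))
    \<longlonglongrightarrow> (t\<^sup>2 / 2 * pair a f0 + t * (pair a g0 - pair a g) + (pair a (app (P t) h) - pair a h)) / t\<^sup>2"
proof -
  define \<phi> where "\<phi> x = pair a (app (P x) f)" for x
  define F1 where "F1 x = x * pair a f0 + pair a (app (P x) g)" for x
  define F3 where "F3 x = x\<^sup>2 / 2 * pair a f0 + x * pair a g0 + pair a (app (P x) h)" for x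
  have split: "pair a (app (P x) b) = pair a b0 + pair a (app (P x) (app (generator r) c))"
    if "app (generator r) b0 = (\<lambda>_. 0)" "\<And>s. b s = b0 s + app (generator r) c s" "x \<ge> 0" for x b b0 c
  proof -
    have "app (P x) b s = app (P x) b0 s + app (P x) (app (generator r) c) s" for s
      by (simp add: app_def[of "P x"] that(2) distrib_left sum.distrib)
    then show ?thesis
      using app_P_harmonic[OF that(1,3)] by (simp add: distrib_left sum.distrib)
  qed
  have d1: "(F1 has_real_derivative \<phi> x) (at x within {0..})" if "x \<ge> 0" for x
    unfolding F1_def \<phi>_def split[OF f0 f that]
    by (rule derivative_eq_intros pair_P_deriv that | simp)+
  have d3: "(F3 has_real_derivative F1 x) (at x within {0..})" if "x \<ge> 0" for x
    unfolding F3_def F1_def split[OF g0 g that]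
    by (rule derivative_eq_intros pair_P_deriv that | simp)+
  have cont: "continuous_on {0..} \<phi>"
    unfolding \<phi>_def by (rule continuous_on_pair_P)
  have r1: "(\<lambda>k. t / real k * (\<Sum>i<k. \<phi> (t * real i / real k))) \<longlonglongrightarrow> F1 t - F1 0"
    by (rule riemann_sum_tendsto[OF t d1 cont])
  \<comment> \<open>Integration by parts: \<open>(t - x) * F1 x + F3 x\<close> has derivative
    \<open>(t - x) * \<phi> x\<close>, since the two contributions of \<open>F1\<close>
    cancel.\<close>
  have r2: "(\<lambda>k. t / real k * (\<Sum>i<k. (t - t * real i / real k) * \<phi> (t * real i / real k)))
     \<longlonglongrightarrow> ((t - t) * F1 t + F3 t) - ((t - 0) * F1 0 + F3 0)"
    by (rule riemann_sum_tendsto[OF t, of "\<lambda>x. (t - x) * F1 x + F3 x" "\<lambda>x. (t - x) * \<phi> x"])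
       (auto intro!: derivative_eq_intros d1 d3 continuous_intros cont)
  have inv: "(\<lambda>k. 1 / real k) \<longlonglongrightarrow> 0" by (rule lim_1_over_n)
  \<comment> \<open>The subtracted term stems from the 1 in the multiplicity
    \<open>k - 1 - i\<close>; it is \<open>1 / k\<close> times a convergent Riemann sum and
    disappears in the limit.\<close>
  have lim: "(\<lambda>k. (t / real k * (\<Sum>i<k. (t - t * real i / real k) * \<phi> (t * real i / real k))) / t\<^sup>2
       - 1 / real k * (t / real k * (\<Sum>i<k. \<phi> (t * real i / real k))) / t)
     \<longlonglongrightarrow> (((t - t) * F1 t + F3 t) - ((t - 0) * F1 0 + F3 0)) / t\<^sup>2 - 0 * (F1 t - F1 0) / t"
    using t by (intro tendsto_diff tendsto_divide tendsto_const tendsto_mult[OF inv r1] r2) auto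
  have eq: "mean_pairs k (\<lambda>i. \<phi> (t * real i / real k))
     = (t / real k * (\<Sum>i<k. (t - t * real i / real k) * \<phi> (t * real i / real k))) / t\<^sup>2
       - 1 / real k * (t / real k * (\<Sum>i<k. \<phi> (t * real i / real k))) / t" if "k > 0" for k
  proof -
    have "(\<Sum>i<k. (real k - 1 - real i) * \<phi> (t * real i / real k))
      = real k / t * (\<Sum>i<k. (t - t * real i / real k) * \<phi> (t * real i / real k))
        - (\<Sum>i<k. \<phi> (t * real i / real k))"
      unfolding sum_distrib_left sum_subtractf[symmetric]
      by (rule sum.cong) (use t that in \<open>auto simp: field_simps\<close>)
    then show ?thesis using t that
      by (simp add: mean_pairs_def sum_sum_lessThan diff_divide_distrib power2_eq_square)
  qed
  have "(\<lambda>k. mean_pairs k (\<lambda>i. \<phi> (t * real i / real k)))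
     \<longlonglongrightarrow> (((t - t) * F1 t + F3 t) - ((t - 0) * F1 0 + F3 0)) / t\<^sup>2 - 0 * (F1 t - F1 0) / t"
    by (rule Lim_transform_eventually[OF lim])
       (rule eventually_mono[OF eventually_gt_at_top[of "0::nat"]], rule eq[symmetric])
  moreover have "(((t - t) * F1 t + F3 t) - ((t - 0) * F1 0 + F3 0)) / t\<^sup>2 - 0 * (F1 t - F1 0) / t
     = (t\<^sup>2 / 2 * pair a f0 + t * (pair a g0 - pair a g) + (pair a (app (P t) h) - pair a h)) / t\<^sup>2"
    by (simp add: F1_def F3_def algebra_simps)
  ultimately show ?thesis by (simp only: \<phi>_def)
qed

lemma abs_pair_app_P_le:
  assumes "x \<ge> 0"
  shows "\<bar>pair a (app (P x) f)\<bar> \<le> (\<Sum>s\<in>UNIV. \<bar>a s\<bar>) * (\<Sum>s\<in>UNIV. \<bar>f s\<bar>)"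
proof -
  have "\<bar>pair a (app (P x) f)\<bar> \<le> (\<Sum>s\<in>UNIV. \<bar>a s\<bar> * \<bar>app (P x) f s\<bar>)"
    using sum_abs[of "\<lambda>s. a s * app (P x) f s"] by (simp add: abs_mult)
  also have "\<dots> \<le> (\<Sum>s\<in>UNIV. \<bar>a s\<bar> * (\<Sum>s\<in>UNIV. \<bar>f s\<bar>))"
    by (intro sum_mono mult_left_mono abs_app_P_le assms) simp
  finally show ?thesis by (simp add: sum_distrib_right)
qed

text \<open>The rescaled step contributions depend on the mesh. Their distance \<open>e k\<close>
  from the limiting vectors, with first \<open>a\<close> and then \<open>b\<close> exchanged, is
  uniform in the lag because the semigroup is bounded uniformly in time.\<close>

lemma mean_pairs_tendsto:
  assumes t: "t > 0"
    and a: "\<And>s. (\<lambda>k. a k s) \<longlonglongrightarrow> a' s" and b: "\<And>s. (\<lambda>k. b k s) \<longlonglongrightarrow> f s"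
    and f0: "app (generator r) f0 = (\<lambda>_. 0)" and f: "\<And>s. f s = f0 s + app (generator r) g s"
    and g0: "app (generator r) g0 = (\<lambda>_. 0)" and g: "\<And>s. g s = g0 s + app (generator r) h s"
  shows "(\<lambda>k. mean_pairs k (\<lambda>i. pair (a k) (app (P (t * real i / real k)) (b k))))
    \<longlonglongrightarrow> (t\<^sup>2 / 2 * pair a' f0 + t * (pair a' g0 - pair a' g) + (pair a' (app (P t) h) - pair a' h)) / t\<^sup>2"
proof -
  define e where "e k = (\<Sum>s\<in>UNIV. \<bar>a k s - a' s\<bar>) * (\<Sum>s\<in>UNIV. \<bar>b k s\<bar>)
      + (\<Sum>s\<in>UNIV. \<bar>a' s\<bar>) * (\<Sum>s\<in>UNIV. \<bar>b k s - f s\<bar>)" for k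
  have "e \<longlonglongrightarrow> (\<Sum>s\<in>UNIV. \<bar>a' s - a' s\<bar>) * (\<Sum>s\<in>UNIV. \<bar>f s\<bar>)
      + (\<Sum>s\<in>UNIV. \<bar>a' s\<bar>) * (\<Sum>s\<in>UNIV. \<bar>f s - f s\<bar>)"
    unfolding e_def[abs_def] by (intro tendsto_intros a b)
  then have e: "e \<longlonglongrightarrow> 0" by simp
  have bound: "\<bar>pair (a k) (app (P x) (b k)) - pair a' (app (P x) f)\<bar> \<le> e k" if "x \<ge> 0" for k x
  proof -
    have "pair (a k) (app (P x) (b k)) - pair a' (app (P x) f)
       = pair (\<lambda>s. a k s - a' s) (app (P x) (b k)) + pair a' (app (P x) (\<lambda>s. b k s - f s))"
      by (simp add: app_def algebra_simps sum.distrib sum_subtractf)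
    then show ?thesis
      using abs_pair_app_P_le[OF that, of "\<lambda>s. a k s - a' s" "b k"]
        abs_pair_app_P_le[OF that, of a' "\<lambda>s. b k s - f s"] by (simp add: e_def)
  qed
  have "(\<lambda>k. mean_pairs k (\<lambda>i. pair (a k) (app (P (t * real i / real k)) (b k)))
      - mean_pairs k (\<lambda>i. pair a' (app (P (t * real i / real k)) f))) \<longlonglongrightarrow> 0"
    by (rule Lim_null_comparison[OF _ e])
       (use t in \<open>auto intro!: always_eventually mean_pairs_diff_le bound\<close>)
  from tendsto_add[OF this mean_pairs_const_tendsto[OF t f0 f g0 g, of a']]
  show ?thesis by simp
qed

end

subsection \<open>Moments on a grid\<close>

lemma (in prob_space) expectation_finite_valued:
  fixes Y :: "'a \<Rightarrow> 'b::finite" and h :: "'b \<Rightarrow> real"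
  assumes "Y \<in> measurable M (count_space UNIV)"
  shows "integrable M (\<lambda>\<omega>. h (Y \<omega>))"
    and "expectation (\<lambda>\<omega>. h (Y \<omega>)) = (\<Sum>y\<in>UNIV. h y * prob {\<omega> \<in> space M. Y \<omega> = y})"
proof -
  have [measurable]: "{\<omega> \<in> space M. Y \<omega> = y} \<in> sets M" for y
    using measurable_sets[OF assms, of "{y}"] by (simp add: vimage_def Int_def conj_commute)
  define I where "I = (\<lambda>\<omega>. \<Sum>y\<in>UNIV. h y * indicator {\<omega> \<in> space M. Y \<omega> = y} \<omega>)"
  have eq: "h (Y \<omega>) = I \<omega>" if "\<omega> \<in> space M" for \<omega>
    using that by (simp add: I_def indicator_def of_bool_def if_distrib cong: if_cong)
  have int: "integrable M (\<lambda>\<omega>. h y * indicator {\<omega> \<in> space M. Y \<omega> = y} \<omega>)" for y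
    by (intro integrable_mult_right integrable_real_indicator) (auto simp: emeasure_eq_measure)
  have "integrable M I" unfolding I_def by (intro Bochner_Integration.integrable_sum int)
  then show "integrable M (\<lambda>\<omega>. h (Y \<omega>))"
    by (simp add: eq cong: Bochner_Integration.integrable_cong)
  have "expectation (\<lambda>\<omega>. h (Y \<omega>)) = expectation I"
    by (rule Bochner_Integration.integral_cong) (simp_all add: eq)
  also have "\<dots> = (\<Sum>y\<in>UNIV. h y * prob {\<omega> \<in> space M. Y \<omega> = y})"
    unfolding I_def by (subst Bochner_Integration.integral_sum[OF int]) simp
  finally show "expectation (\<lambda>\<omega>. h (Y \<omega>)) = (\<Sum>y\<in>UNIV. h y * prob {\<omega> \<in> space M. Y \<omega> = y})" .
qed

lemma square_sum_lessThan:
  fixes k :: nat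
  shows "(\<Sum>j<k. y j :: real)\<^sup>2 = (\<Sum>j<k. (y j)\<^sup>2) + 2 * (\<Sum>j<k. \<Sum>i<j. y i * y j)"
  by (induction k) (simp_all add: power2_sum sum_distrib_left sum_distrib_right algebra_simps)

text \<open>A single \<open>P\<close> is fixed for the path distributions and for the semigroup;
  \<open>finite_dim_distr\<close> alone asserts just the existence of one.\<close>

locale stationary_jump_process = markov_jump_process M r p X + transition r P
  for M :: "'w measure" and r :: "'s::finite \<Rightarrow> 's \<Rightarrow> real" and p X P +
  assumes stationary: "stationary r p"
    and path_distr: "\<tau> 0 = 0 \<Longrightarrow> mono \<tau> \<Longrightarrow>
      prob {\<omega> \<in> space M. \<forall>k\<le>n. X (\<tau> k) \<omega> = s k}
        = pmf p (s 0) * (\<Prod>k<n. P (\<tau> (Suc k) - \<tau> k) (s k) (s (Suc k)))"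
begin

text \<open>Both the evolved distribution and the constant \<open>p\<close> solve the forward
  equation with initial value \<open>p\<close>, so uniqueness applies.\<close>

lemma stationary_P:
  assumes "t \<ge> 0" shows "(\<Sum>s\<in>UNIV. pmf p s * P t s s') = pmf p s'"
proof (rule forward_equation_unique[OF rate_nonneg, where v = "\<lambda>t s'. \<Sum>s\<in>UNIV. pmf p s * P t s s'" and w = "\<lambda>_. pmf p"])
  fix t :: real and s' :: 's assume t: "t \<ge> 0"
  have "((\<lambda>\<tau>. \<Sum>s\<in>UNIV. pmf p s * P \<tau> s s') has_real_derivative
     (\<Sum>s\<in>UNIV. pmf p s * (\<Sum>u\<in>UNIV. P t s u * generator r u s'))) (at t within {0..})"
    by (intro DERIV_sum DERIV_cmult P_deriv t)
  moreover have "(\<Sum>s\<in>UNIV. pmf p s * (\<Sum>u\<in>UNIV. P t s u * generator r u s'))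
     = (\<Sum>u\<in>UNIV. (\<Sum>s\<in>UNIV. pmf p s * P t s u) * generator r u s')"
    unfolding sum_distrib_left sum_distrib_right by (subst sum.swap) (simp add: mult_ac)
  ultimately show "((\<lambda>\<tau>. \<Sum>s\<in>UNIV. pmf p s * P \<tau> s s') has_real_derivative
     (\<Sum>u\<in>UNIV. (\<Sum>s\<in>UNIV. pmf p s * P t s u) * generator r u s')) (at t within {0..})" by simp
  show "((\<lambda>_. pmf p s') has_real_derivative (\<Sum>u\<in>UNIV. pmf p u * generator r u s')) (at t within {0..})"
    using stationary by (simp add: stationary_def)
qed (use assms in \<open>simp_all add: P_0\<close>)

text \<open>For a step of length \<open>h\<close> started from \<open>p\<close>, this is the mean of
  \<open>F\<close> on the event that the step ends in \<open>s'\<close>. Its counterpart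
  \<open>bwd\<close> is the conditional mean of \<open>F\<close> given the starting state. Two
  separated steps interact through \<open>fwd\<close> of the earlier one, the semigroup over the
  gap, and \<open>bwd\<close> of the later one.\<close>

definition fwd :: "('s \<Rightarrow> 's \<Rightarrow> real) \<Rightarrow> real \<Rightarrow> 's \<Rightarrow> real" where
  "fwd F h s' = (\<Sum>s\<in>UNIV. pmf p s * (P h s s' * F s s'))"

definition bwd :: "('s \<Rightarrow> 's \<Rightarrow> real) \<Rightarrow> real \<Rightarrow> 's \<Rightarrow> real" where
  "bwd F h s = (\<Sum>s'\<in>UNIV. P h s s' * F s s')"

lemma expectation_four_times:
  assumes t: "0 \<le> a" "a \<le> b" "b \<le> c" "c \<le> d"
  shows "integrable M (\<lambda>\<omega>. F (X a \<omega>) (X b \<omega>) * H (X c \<omega>) (X d \<omega>))"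
    and "expectation (\<lambda>\<omega>. F (X a \<omega>) (X b \<omega>) * H (X c \<omega>) (X d \<omega>))
      = pair (fwd F (b - a)) (app (P (c - b)) (bwd H (d - c)))"
proof -
  \<comment> \<open>Time 0 is included because \<open>path_distr\<close> describes paths observed
    from time 0 on; stationarity removes it again when the sum over \<open>z\<close> is carried
    out.\<close>
  define Y where "Y \<omega> = (X 0 \<omega>, X a \<omega>, X b \<omega>, X c \<omega>, X d \<omega>)" for \<omega>
  define h where "h = (\<lambda>(x0 :: 's, x, y, u, v). F x y * H u v)"
  have [measurable]: "X 0 \<in> measurable M (count_space UNIV)" "X a \<in> measurable M (count_space UNIV)"
    "X b \<in> measurable M (count_space UNIV)" "X c \<in> measurable M (count_space UNIV)"
    "X d \<in> measurable M (count_space UNIV)"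
    using t by (auto intro!: measurable_state)
  have Y: "Y \<in> measurable M (count_space UNIV)"
    unfolding Y_def
    by (rule measurable_count_space_eq2[THEN iffD2]) auto
  have hY: "h (Y \<omega>) = F (X a \<omega>) (X b \<omega>) * H (X c \<omega>) (X d \<omega>)" for \<omega>
    by (simp add: h_def Y_def)
  show "integrable M (\<lambda>\<omega>. F (X a \<omega>) (X b \<omega>) * H (X c \<omega>) (X d \<omega>))"
    using expectation_finite_valued(1)[OF Y, of h] by (simp add: hY)
  have pr: "prob {\<omega> \<in> space M. Y \<omega> = (z, x, y, u, v)}
      = pmf p z * P a z x * P (b - a) x y * P (c - b) y u * P (d - c) u v" for z x y u v
  proof -
    \<comment> \<open>Capping the index at 4 makes the sequence constant afterwards, hence monotone
      on all naturals as \<open>path_distr\<close> demands.\<close>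
    define \<tau> where "\<tau> k = [0, a, b, c, d] ! min k 4" for k :: nat
    define \<sigma> where "\<sigma> k = [z, x, y, u, v] ! min k 4" for k :: nat
    have "mono \<tau>"
    proof (rule mono_iff_le_Suc[THEN iffD2], rule allI)
      fix k show "\<tau> k \<le> \<tau> (Suc k)"
      proof (cases "k < 4")
        case True
        then have "k = 0 \<or> k = 1 \<or> k = 2 \<or> k = 3" by auto
        then show ?thesis using t by (auto simp: \<tau>_def)
      qed (simp add: \<tau>_def min_def)
    qed
    have set: "{\<omega> \<in> space M. Y \<omega> = (z, x, y, u, v)} = {\<omega> \<in> space M. \<forall>k\<le>4. X (\<tau> k) \<omega> = \<sigma> k}"
      by (auto simp: Y_def \<tau>_def \<sigma>_def numeral_eq_Suc le_Suc_eq)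
    show ?thesis
      unfolding set by (subst path_distr) (use \<open>mono \<tau>\<close> in \<open>simp_all add: \<tau>_def \<sigma>_def numeral_eq_Suc\<close>)
  qed
  have "expectation (\<lambda>\<omega>. h (Y \<omega>)) =
      (\<Sum>z\<in>UNIV. \<Sum>x\<in>UNIV. \<Sum>y\<in>UNIV. \<Sum>u\<in>UNIV. \<Sum>v\<in>UNIV. F x y * H u v *
        (pmf p z * P a z x * P (b - a) x y * P (c - b) y u * P (d - c) u v))"
    unfolding expectation_finite_valued(2)[OF Y, of h]
    by (simp only: UNIV_Times_UNIV[symmetric] sum.cartesian_product' pr h_def prod.case)
  also have "\<dots> = (\<Sum>z\<in>UNIV. \<Sum>x\<in>UNIV. \<Sum>y\<in>UNIV. (pmf p z * P a z x) * (P (b - a) x y * F x y *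
       app (P (c - b)) (bwd H (d - c)) y))"
    by (simp add: app_def bwd_def sum_distrib_left mult_ac)
  also have "\<dots> = (\<Sum>x\<in>UNIV. \<Sum>y\<in>UNIV. (\<Sum>z\<in>UNIV. pmf p z * P a z x) * (P (b - a) x y * F x y *
       app (P (c - b)) (bwd H (d - c)) y))"
    unfolding sum_distrib_right
    by (subst sum.swap, intro sum.cong refl sum.swap)
  also have "\<dots> = (\<Sum>y\<in>UNIV. \<Sum>x\<in>UNIV. pmf p x * (P (b - a) x y * F x y *
       app (P (c - b)) (bwd H (d - c)) y))"
    using t by (subst sum.swap) (simp add: stationary_P)
  also have "\<dots> = pair (fwd F (b - a)) (app (P (c - b)) (bwd H (d - c)))"
    by (simp add: fwd_def sum_distrib_right sum_distrib_left mult_ac)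
  finally show "expectation (\<lambda>\<omega>. F (X a \<omega>) (X b \<omega>) * H (X c \<omega>) (X d \<omega>))
      = pair (fwd F (b - a)) (app (P (c - b)) (bwd H (d - c)))" by (simp add: hY)
qed

lemma expectation_two_times:
  assumes t: "0 \<le> a" "a \<le> b"
  shows "integrable M (\<lambda>\<omega>. F (X a \<omega>) (X b \<omega>))"
    and "expectation (\<lambda>\<omega>. F (X a \<omega>) (X b \<omega>)) = (\<Sum>s\<in>UNIV. fwd F (b - a) s)"
  using expectation_four_times[OF t order.refl order.refl, of F "\<lambda>_ _. 1"]
  by (simp_all add: bwd_def P_row_sum)

definition grid_sum :: "('s \<Rightarrow> 's \<Rightarrow> real) \<Rightarrow> real \<Rightarrow> nat \<Rightarrow> 'w \<Rightarrow> real" where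
  "grid_sum F t k \<omega> = (\<Sum>j<k. F (X (t * real j / real k) \<omega>) (X (t * real (Suc j) / real k) \<omega>))"

lemma grid_mono:
  assumes "t > 0" "i \<le> j" shows "t * real i / real k \<le> t * real j / real k"
  using assms by (intro divide_right_mono mult_left_mono) auto

lemma grid_diff: "t * real (Suc j) / real k - t * real j / real k = t / real k"
  by (simp add: algebra_simps add_divide_distrib)

lemma integrable_grid_sum:
  assumes "t > 0" shows "integrable M (grid_sum F t k)"
  unfolding grid_sum_def[abs_def] using assms
  by (intro Bochner_Integration.integrable_sum expectation_two_times(1) grid_mono) auto

lemma expectation_grid_sum:
  assumes "t > 0" shows "expectation (grid_sum F t k) = real k * (\<Sum>s\<in>UNIV. fwd F (t / real k) s)"
proof -
  have "expectation (grid_sum F t k) =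
      (\<Sum>j<k. expectation (\<lambda>\<omega>. F (X (t * real j / real k) \<omega>) (X (t * real (Suc j) / real k) \<omega>)))"
    unfolding grid_sum_def[abs_def] using assms
    by (intro Bochner_Integration.integral_sum expectation_two_times(1) grid_mono) auto
  also have "\<dots> = (\<Sum>j<k. \<Sum>s\<in>UNIV. fwd F (t / real k) s)"
    using assms by (intro sum.cong refl) (subst expectation_two_times(2), auto intro!: grid_mono simp only: grid_diff, simp)
  finally show ?thesis by simp
qed

text \<open>Diagonal terms give the mean square of one step. Off the diagonal the Markov property
  and stationarity leave a dependence on the lag between the two steps alone.\<close>

lemma expectation_grid_sum_square:
  assumes "t > 0"
  shows "integrable M (\<lambda>\<omega>. (grid_sum F t k \<omega>)\<^sup>2)"
    and "expectation (\<lambda>\<omega>. (grid_sum F t k \<omega>)\<^sup>2) =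
      real k * (\<Sum>s\<in>UNIV. fwd (\<lambda>s s'. (F s s')\<^sup>2) (t / real k) s)
      + 2 * (\<Sum>j<k. \<Sum>i<j. pair (fwd F (t / real k)) (app (P (t * real i / real k)) (bwd F (t / real k))))"
proof -
  define x where "x j = t * real j / real k" for j
  have mono: "x i \<le> x j" if "i \<le> j" for i j using grid_mono[OF assms that] by (simp add: x_def)
  have x0: "x i \<ge> 0" for i using assms by (simp add: x_def)
  have xd: "x (Suc j) - x j = t / real k" for j using grid_diff by (simp add: x_def)
  define y where "y j \<omega> = F (X (x j) \<omega>) (X (x (Suc j)) \<omega>)" for j \<omega>
  have sq: "(grid_sum F t k \<omega>)\<^sup>2 = (\<Sum>j<k. (y j \<omega>)\<^sup>2) + 2 * (\<Sum>j<k. \<Sum>i<j. y i \<omega> * y j \<omega>)" for \<omega>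
    unfolding grid_sum_def y_def x_def by (rule square_sum_lessThan)
  have y2: "integrable M (\<lambda>\<omega>. (y j \<omega>)\<^sup>2)"
    "expectation (\<lambda>\<omega>. (y j \<omega>)\<^sup>2) = (\<Sum>s\<in>UNIV. fwd (\<lambda>s s'. (F s s')\<^sup>2) (t / real k) s)" for j
    unfolding y_def using expectation_two_times[OF x0 mono[of j "Suc j"], of "\<lambda>s s'. (F s s')\<^sup>2"]
    by (simp_all add: xd)
  have yy: "integrable M (\<lambda>\<omega>. y i \<omega> * y j \<omega>)"
    "expectation (\<lambda>\<omega>. y i \<omega> * y j \<omega>)
      = pair (fwd F (t / real k)) (app (P (t * real (j - Suc i) / real k)) (bwd F (t / real k)))"
    if "i < j" for i j
  proof -
    have "x j - x (Suc i) = t * real (j - Suc i) / real k"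
      using that by (simp add: x_def diff_divide_distrib[symmetric] right_diff_distrib[symmetric] of_nat_diff)
    then show "integrable M (\<lambda>\<omega>. y i \<omega> * y j \<omega>)" "expectation (\<lambda>\<omega>. y i \<omega> * y j \<omega>)
      = pair (fwd F (t / real k)) (app (P (t * real (j - Suc i) / real k)) (bwd F (t / real k)))"
      unfolding y_def using expectation_four_times[OF x0 mono mono mono, of i "Suc i" j "Suc j" F F] that
      by (simp_all add: xd)
  qed
  have int: "integrable M (\<lambda>\<omega>. \<Sum>j<k. (y j \<omega>)\<^sup>2)" "integrable M (\<lambda>\<omega>. \<Sum>j<k. \<Sum>i<j. y i \<omega> * y j \<omega>)"
    by (auto intro!: Bochner_Integration.integrable_sum y2 yy)
  then show "integrable M (\<lambda>\<omega>. (grid_sum F t k \<omega>)\<^sup>2)" unfolding sq by auto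
  have "expectation (\<lambda>\<omega>. (grid_sum F t k \<omega>)\<^sup>2)
     = expectation (\<lambda>\<omega>. \<Sum>j<k. (y j \<omega>)\<^sup>2) + 2 * expectation (\<lambda>\<omega>. \<Sum>j<k. \<Sum>i<j. y i \<omega> * y j \<omega>)"
    unfolding sq using int by simp
  also have "expectation (\<lambda>\<omega>. \<Sum>j<k. (y j \<omega>)\<^sup>2) = real k * (\<Sum>s\<in>UNIV. fwd (\<lambda>s s'. (F s s')\<^sup>2) (t / real k) s)"
    by (subst Bochner_Integration.integral_sum) (simp_all add: y2)
  also have "expectation (\<lambda>\<omega>. \<Sum>j<k. \<Sum>i<j. y i \<omega> * y j \<omega>)
     = (\<Sum>j<k. \<Sum>i<j. expectation (\<lambda>\<omega>. y i \<omega> * y j \<omega>))"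
    by (subst Bochner_Integration.integral_sum)
       (auto intro!: sum.cong Bochner_Integration.integral_sum Bochner_Integration.integrable_sum yy)
  also have "\<dots> = (\<Sum>j<k. \<Sum>i<j.
      pair (fwd F (t / real k)) (app (P (t * real (j - Suc i) / real k)) (bwd F (t / real k))))"
    by (intro sum.cong refl) (simp add: yy)
  \<comment> \<open>For fixed \<open>j\<close> the gap \<open>j - Suc i\<close> runs through 0, ...,
    \<open>j - 1\<close> in reverse order; it starts at 0 because adjacent steps share a time
    point.\<close>
  also have "\<dots> = (\<Sum>j<k. \<Sum>i<j. pair (fwd F (t / real k)) (app (P (t * real i / real k)) (bwd F (t / real k))))"
    by (intro sum.cong refl sum.nat_diff_reindex)
  finally show "expectation (\<lambda>\<omega>. (grid_sum F t k \<omega>)\<^sup>2) =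
      real k * (\<Sum>s\<in>UNIV. fwd (\<lambda>s s'. (F s s')\<^sup>2) (t / real k) s)
      + 2 * (\<Sum>j<k. \<Sum>i<j. pair (fwd F (t / real k)) (app (P (t * real i / real k)) (bwd F (t / real k))))" .
qed

end

section \<open>Short-time limits of tilted steps\<close>

context transition
begin

lemma P_mesh_rate:
  assumes "t > 0"
  shows "(\<lambda>k. real k / t * (P (t / real k) s s' - of_bool (s = s'))) \<longlonglongrightarrow> generator r s s'"
proof -
  have "((\<lambda>\<tau>. P \<tau> s s') has_real_derivative generator r s s') (at 0 within {0..})"
    using P_deriv[of 0 s s'] by (simp add: P_0)
  then have "((\<lambda>\<tau>. (P \<tau> s s' - of_bool (s = s')) / \<tau>) \<longlongrightarrow> generator r s s') (at 0 within {0..})"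
    by (simp add: has_field_derivative_iff P_0)
  moreover have "filterlim (\<lambda>k. t / real k) (at 0 within {0..}) sequentially"
    unfolding filterlim_at
  proof
    show "\<forall>\<^sub>F k in sequentially. t / real k \<in> {0..} \<and> t / real k \<noteq> 0"
      using eventually_gt_at_top[of "0::nat"] by eventually_elim (use assms in auto)
    show "(\<lambda>k. t / real k) \<longlonglongrightarrow> 0" by (rule lim_const_over_n)
  qed
  ultimately have "(\<lambda>k. (P (t / real k) s s' - of_bool (s = s')) / (t / real k)) \<longlonglongrightarrow> generator r s s'"
    by (rule filterlim_compose)
  then show ?thesis by (simp add: mult.commute)
qed

lemma P_mesh_tendsto:
  assumes "t > 0"
  shows "(\<lambda>k. P (t / real k) s s') \<longlonglongrightarrow> of_bool (s = s')"
proof -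
  have "(\<lambda>k. t / real k * (real k / t * (P (t / real k) s s' - of_bool (s = s'))) + of_bool (s = s'))
      \<longlonglongrightarrow> 0 * generator r s s' + of_bool (s = s')"
    by (intro tendsto_intros P_mesh_rate assms lim_const_over_n)
  then have "(\<lambda>k. t / real k * (real k / t * (P (t / real k) s s' - of_bool (s = s'))) + of_bool (s = s'))
      \<longlonglongrightarrow> of_bool (s = s')" by simp
  then show ?thesis
    by (rule Lim_transform_eventually)
       (use assms in \<open>auto intro!: always_eventually simp: P_0\<close>)
qed

text \<open>The weight \<open>W\<close> plus \<open>c\<close> times the score step. Given
  \<open>s\<close>, the score step has mean exactly zero at every mesh, since
  \<open>1 - P h s s\<close> is the probability of ending elsewhere.\<close>

definition tilt :: "('s \<Rightarrow> 's \<Rightarrow> real) \<Rightarrow> real \<Rightarrow> real \<Rightarrow> 's \<Rightarrow> 's \<Rightarrow> real" where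
  "tilt W c h s s' = W s s' + c * (of_bool (s \<noteq> s') - (1 - P h s s))"

lemma tilt_0 [simp]: "tilt W 0 h = W"
  by (simp add: tilt_def fun_eq_iff)

lemma tilt_tendsto:
  assumes "t > 0"
  shows "(\<lambda>k. tilt W c (t / real k) s s') \<longlonglongrightarrow> W s s' + c * of_bool (s \<noteq> s')"
proof -
  have "(\<lambda>k. tilt W c (t / real k) s s') \<longlonglongrightarrow> W s s' + c * (of_bool (s \<noteq> s') - (1 - of_bool (s = s)))"
    unfolding tilt_def by (intro tendsto_intros P_mesh_tendsto assms)
  then show ?thesis by simp
qed

text \<open>On the diagonal \<open>W\<close> vanishes and the tilt is
  \<open>c * (P h s s - 1)\<close>, of order \<open>h\<close>. Staying put has probability near 1,
  so this survives the rescaling as \<open>c * generator r s s\<close>; hence \<open>c\<close>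
  multiplies the full generator, diagonal included.\<close>

lemma tilt_rate:
  assumes t: "t > 0" and W: "W s s = 0"
  shows "(\<lambda>k. real k / t * (P (t / real k) s s' * tilt W c (t / real k) s s'))
    \<longlonglongrightarrow> generator r s s' * (W s s' + c)"
proof (cases "s = s'")
  case True
  have "(\<lambda>k. P (t / real k) s s * c * (real k / t * (P (t / real k) s s - of_bool (s = s))))
      \<longlonglongrightarrow> of_bool (s = s) * c * generator r s s"
    by (intro tendsto_intros P_mesh_tendsto P_mesh_rate t)
  then show ?thesis using True W by (simp add: tilt_def algebra_simps)
next
  case False
  have "(\<lambda>k. (real k / t * (P (t / real k) s s' - of_bool (s = s'))) * tilt W c (t / real k) s s')
      \<longlonglongrightarrow> generator r s s' * (W s s' + c * of_bool (s \<noteq> s'))"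
    by (intro tendsto_intros P_mesh_rate tilt_tendsto t)
  then show ?thesis using False by (simp add: mult_ac)
qed

text \<open>The second factor \<open>tilt\<close> tends to 0 on the diagonal, so in the square only
  changes of state remain. This is the source of the activity term.\<close>

lemma tilt_square_rate:
  assumes t: "t > 0" and W: "W s s = 0"
  shows "(\<lambda>k. real k / t * (P (t / real k) s s' * (tilt W c (t / real k) s s')\<^sup>2))
    \<longlonglongrightarrow> generator r s s' * (of_bool (s \<noteq> s') * (W s s' + c)\<^sup>2)"
proof -
  have "(\<lambda>k. real k / t * (P (t / real k) s s' * tilt W c (t / real k) s s') * tilt W c (t / real k) s s')
    \<longlonglongrightarrow> generator r s s' * (W s s' + c) * (W s s' + c * of_bool (s \<noteq> s'))"
    by (intro tendsto_mult tilt_rate tilt_tendsto assms)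
  moreover have "generator r s s' * (W s s' + c) * (W s s' + c * of_bool (s \<noteq> s'))
     = generator r s s' * (of_bool (s \<noteq> s') * (W s s' + c)\<^sup>2)"
    using W by (cases "s = s'") (auto simp: power2_eq_square)
  ultimately have "(\<lambda>k. real k / t * (P (t / real k) s s' * tilt W c (t / real k) s s') * tilt W c (t / real k) s s')
    \<longlonglongrightarrow> generator r s s' * (of_bool (s \<noteq> s') * (W s s' + c)\<^sup>2)" by (simp only:)
  then show ?thesis by (simp only: power2_eq_square mult.assoc)
qed

end

section \<open>Limits of the mean and second moment on fine grids\<close>

context stationary_jump_process
begin

text \<open>For weights vanishing on the diagonal, \<open>influx\<close> is the mean weight per unit
  time collected by jumps into a state, \<open>drift\<close> the conditional rate of collecting
  weight in a state, and \<open>flux\<close> the mean stationary current.\<close>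

definition influx :: "('s \<Rightarrow> 's \<Rightarrow> real) \<Rightarrow> 's \<Rightarrow> real" where
  "influx W s' = (\<Sum>s\<in>UNIV. pmf p s * (generator r s s' * W s s'))"

definition drift :: "('s \<Rightarrow> 's \<Rightarrow> real) \<Rightarrow> 's \<Rightarrow> real" where
  "drift W s = (\<Sum>s'\<in>UNIV. generator r s s' * W s s')"

definition flux :: "('s \<Rightarrow> 's \<Rightarrow> real) \<Rightarrow> real" where
  "flux W = (\<Sum>s'\<in>UNIV. influx W s')"

definition activity :: real where
  "activity = flux (\<lambda>s s'. of_bool (s \<noteq> s'))"

text \<open>Tilting leaves the limit of the influx unchanged because \<open>p\<close> is stationary, and that of the
  drift because the rows of the generator sum to zero.\<close>

lemma fwd_tilt_tendsto:
  assumes t: "t > 0" and W: "\<And>s. W s s = 0"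
  shows "(\<lambda>k. real k / t * fwd (tilt W c (t / real k)) (t / real k) s') \<longlonglongrightarrow> influx W s'"
proof -
  have "(\<lambda>k. \<Sum>s\<in>UNIV. pmf p s * (real k / t * (P (t / real k) s s' * tilt W c (t / real k) s s')))
      \<longlonglongrightarrow> (\<Sum>s\<in>UNIV. pmf p s * (generator r s s' * (W s s' + c)))"
    by (intro tendsto_intros tilt_rate t W)
  moreover have "(\<Sum>s\<in>UNIV. pmf p s * (generator r s s' * (W s s' + c)))
      = influx W s' + c * (\<Sum>s\<in>UNIV. pmf p s * generator r s s')"
    by (simp add: influx_def algebra_simps sum.distrib sum_distrib_left)
  moreover have "(\<Sum>s\<in>UNIV. pmf p s * generator r s s') = 0"
    using stationary by (simp add: stationary_def)
  moreover have "(\<Sum>s\<in>UNIV. pmf p s * (real k / t * (P (t / real k) s s' * tilt W c (t / real k) s s')))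
      = real k / t * fwd (tilt W c (t / real k)) (t / real k) s'" for k
    by (simp add: fwd_def sum_distrib_left mult_ac)
  ultimately show ?thesis by simp
qed

lemma bwd_tilt_tendsto:
  assumes t: "t > 0" and W: "\<And>s. W s s = 0"
  shows "(\<lambda>k. real k / t * bwd (tilt W c (t / real k)) (t / real k) s) \<longlonglongrightarrow> drift W s"
proof -
  have "(\<lambda>k. \<Sum>s'\<in>UNIV. real k / t * (P (t / real k) s s' * tilt W c (t / real k) s s'))
      \<longlonglongrightarrow> (\<Sum>s'\<in>UNIV. generator r s s' * (W s s' + c))"
    by (intro tendsto_intros tilt_rate t W)
  moreover have "(\<Sum>s'\<in>UNIV. generator r s s' * (W s s' + c)) = drift W s + c * (\<Sum>s'\<in>UNIV. generator r s s')"
    by (simp add: drift_def algebra_simps sum.distrib sum_distrib_left)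
  ultimately show ?thesis by (simp add: bwd_def sum_distrib_left sum_generator)
qed

lemma fwd_tilt_square_tendsto:
  assumes t: "t > 0" and W: "\<And>s. W s s = 0"
  shows "(\<lambda>k. real k / t * fwd (\<lambda>s s'. (tilt W c (t / real k) s s')\<^sup>2) (t / real k) s')
    \<longlonglongrightarrow> influx (\<lambda>s s'. of_bool (s \<noteq> s') * (W s s' + c)\<^sup>2) s'"
proof -
  have "(\<lambda>k. \<Sum>s\<in>UNIV. pmf p s * (real k / t * (P (t / real k) s s' * (tilt W c (t / real k) s s')\<^sup>2)))
      \<longlonglongrightarrow> (\<Sum>s\<in>UNIV. pmf p s * (generator r s s' * (of_bool (s \<noteq> s') * (W s s' + c)\<^sup>2)))"
    by (intro tendsto_intros tilt_square_rate t W)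
  then show ?thesis by (simp add: fwd_def influx_def sum_distrib_left mult_ac)
qed

lemma expectation_grid_sum_tendsto:
  assumes t: "t > 0" and W: "\<And>s. W s s = 0"
  shows "(\<lambda>k. expectation (grid_sum (tilt W c (t / real k)) t k)) \<longlonglongrightarrow> t * flux W"
proof -
  have "(\<lambda>k. t * (\<Sum>s\<in>UNIV. real k / t * fwd (tilt W c (t / real k)) (t / real k) s)) \<longlonglongrightarrow> t * flux W"
    unfolding flux_def by (intro tendsto_intros fwd_tilt_tendsto t W)
  then show ?thesis using t by (simp add: expectation_grid_sum sum_divide_distrib[symmetric] sum_distrib_left[symmetric])
qed

text \<open>The pair terms converge to an expression free of \<open>c\<close>, because tilting
  changes neither the limiting influx nor the limiting drift. The parameter enters through the
  squares of single steps alone.\<close>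

lemma expectation_grid_sum_square_tendsto:
  assumes t: "t > 0" and W: "\<And>s. W s s = 0"
    and f0: "app (generator r) f0 = (\<lambda>_. 0)" and f: "\<And>s. drift W s = f0 s + app (generator r) g s"
    and g0: "app (generator r) g0 = (\<lambda>_. 0)" and g: "\<And>s. g s = g0 s + app (generator r) h s"
  shows "(\<lambda>k. expectation (\<lambda>\<omega>. (grid_sum (tilt W c (t / real k)) t k \<omega>)\<^sup>2)) \<longlonglongrightarrow>
    t * flux (\<lambda>s s'. of_bool (s \<noteq> s') * (W s s' + c)\<^sup>2)
    + 2 * (t\<^sup>2 / 2 * pair (influx W) f0 + t * (pair (influx W) g0 - pair (influx W) g)
       + (pair (influx W) (app (P t) h) - pair (influx W) h))"
    (is "_ \<longlonglongrightarrow> t * ?A + 2 * ?B")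
proof -
  define b where "b k = bwd (tilt W c (t / real k)) (t / real k)" for k
  define a where "a k = fwd (tilt W c (t / real k)) (t / real k)" for k
  have a: "(\<lambda>k. real k / t * a k s) \<longlonglongrightarrow> influx W s" for s
    unfolding a_def by (rule fwd_tilt_tendsto[OF t W])
  have b: "(\<lambda>k. real k / t * b k s) \<longlonglongrightarrow> drift W s" for s
    unfolding b_def by (rule bwd_tilt_tendsto[OF t W])
  have lim: "(\<lambda>k. t * (\<Sum>s\<in>UNIV. real k / t * fwd (\<lambda>s s'. (tilt W c (t / real k) s s')\<^sup>2) (t / real k) s)
     + 2 * (t\<^sup>2 * mean_pairs k (\<lambda>i. pair (\<lambda>s. real k / t * a k s)
          (app (P (t * real i / real k)) (\<lambda>s. real k / t * b k s)))))
     \<longlonglongrightarrow> t * ?A + 2 * (t\<^sup>2 * (?B / t\<^sup>2))"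
    unfolding flux_def
    by (intro tendsto_intros fwd_tilt_square_tendsto mean_pairs_tendsto[OF t a b f0 f g0 g] t W)
  have "expectation (\<lambda>\<omega>. (grid_sum (tilt W c (t / real k)) t k \<omega>)\<^sup>2) =
     t * (\<Sum>s\<in>UNIV. real k / t * fwd (\<lambda>s s'. (tilt W c (t / real k) s s')\<^sup>2) (t / real k) s)
     + 2 * (t\<^sup>2 * mean_pairs k (\<lambda>i. pair (\<lambda>s. real k / t * a k s)
          (app (P (t * real i / real k)) (\<lambda>s. real k / t * b k s))))" for k
  proof -
    \<comment> \<open>Rescaling both step contributions by \<open>k / t\<close> produces a factor
      that cancels against the square of \<open>t\<close> and the normalisation of
      \<open>mean_pairs\<close>.\<close>
    have scale: "pair (\<lambda>s. real k / t * a k s) (app (P x) (\<lambda>s. real k / t * b k s))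
       = (real k / t)\<^sup>2 * pair (a k) (app (P x) (b k))" for x
    proof -
      have "app (P x) (\<lambda>s. real k / t * b k s) s = real k / t * app (P x) (b k) s" for s
        by (simp add: app_def sum_distrib_left mult_ac)
      then show ?thesis by (simp add: sum_distrib_left power2_eq_square mult_ac)
    qed
    have "t\<^sup>2 * mean_pairs k (\<lambda>i. pair (\<lambda>s. real k / t * a k s)
          (app (P (t * real i / real k)) (\<lambda>s. real k / t * b k s)))
       = (\<Sum>j<k. \<Sum>i<j. pair (a k) (app (P (t * real i / real k)) (b k)))"
      unfolding scale mean_pairs_def sum_distrib_left[symmetric]
      using t by (cases "k = 0") (auto simp: power_divide)
    moreover have "t * (\<Sum>s\<in>UNIV. real k / t * fwd (\<lambda>s s'. (tilt W c (t / real k) s s')\<^sup>2) (t / real k) s)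
       = real k * (\<Sum>s\<in>UNIV. fwd (\<lambda>s s'. (tilt W c (t / real k) s s')\<^sup>2) (t / real k) s)"
      unfolding sum_distrib_left[symmetric] using t by simp
    ultimately show ?thesis
      by (simp only: expectation_grid_sum_square(2)[OF t] a_def b_def)
  qed
  with lim show ?thesis using t by simp
qed

lemma flux_tilt:
  assumes "\<And>s. W s s = 0"
  shows "flux (\<lambda>s s'. of_bool (s \<noteq> s') * (W s s' + c)\<^sup>2)
    = flux (\<lambda>s s'. (W s s')\<^sup>2) + 2 * c * flux W + c\<^sup>2 * activity"
proof -
  have "of_bool (s \<noteq> s') * (W s s' + c)\<^sup>2 = (W s s')\<^sup>2 + 2 * c * W s s' + c\<^sup>2 * of_bool (s \<noteq> s')" for s s'
    using assms by (cases "s = s'") (auto simp: power2_sum algebra_simps)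
  then show ?thesis
    by (simp add: flux_def influx_def activity_def distrib_left sum.distrib sum_distrib_left mult_ac)
qed

text \<open>The square of the mean is at most the second moment for every tilted grid sum, and the
  inequality passes to the limit. The pair term \<open>B\<close> is independent of \<open>c\<close>,
  so its value is read off from \<open>m\<close> at \<open>c = 0\<close>.\<close>

lemma second_moment_bound:
  assumes t: "t > 0" and W: "\<And>s. W s s = 0"
    and lim: "(\<lambda>k. expectation (\<lambda>\<omega>. (grid_sum W t k \<omega>)\<^sup>2)) \<longlonglongrightarrow> m"
  shows "(t * flux W)\<^sup>2 \<le> m + t * (2 * c * flux W + c\<^sup>2 * activity)"
proof -
  obtain f0 g g0 h where f: "app (generator r) f0 = (\<lambda>_. 0)" "\<And>s. drift W s = f0 s + app (generator r) g s"
    and g: "app (generator r) g0 = (\<lambda>_. 0)" "\<And>s. g s = g0 s + app (generator r) h s"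
    by (rule harmonic_decomposition_twice[where f = "drift W"]) blast
  note sq = expectation_grid_sum_square_tendsto[OF t W f g]
  define B where "B = 2 * (t\<^sup>2 / 2 * pair (influx W) f0 + t * (pair (influx W) g0 - pair (influx W) g)
       + (pair (influx W) (app (P t) h) - pair (influx W) h))"
  have m: "m = t * flux (\<lambda>s s'. (W s s')\<^sup>2) + B"
    using LIMSEQ_unique[OF lim sq[of 0, simplified tilt_0]] flux_tilt[of W 0, OF W] by (simp add: B_def)
  have "(t * flux W)\<^sup>2 \<le> t * flux (\<lambda>s s'. of_bool (s \<noteq> s') * (W s s' + c)\<^sup>2) + B"
  proof (rule LIMSEQ_le)
    show "(\<lambda>k. (expectation (grid_sum (tilt W c (t / real k)) t k))\<^sup>2) \<longlonglongrightarrow> (t * flux W)\<^sup>2"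
      by (intro tendsto_power expectation_grid_sum_tendsto t W)
    show "(\<lambda>k. expectation (\<lambda>\<omega>. (grid_sum (tilt W c (t / real k)) t k \<omega>)\<^sup>2)) \<longlonglongrightarrow>
        t * flux (\<lambda>s s'. of_bool (s \<noteq> s') * (W s s' + c)\<^sup>2) + B"
      using sq[of c] by (simp add: B_def)
    have "(expectation Y)\<^sup>2 \<le> expectation (\<lambda>\<omega>. (Y \<omega>)\<^sup>2)"
      if "integrable M Y" "integrable M (\<lambda>\<omega>. (Y \<omega>)\<^sup>2)" for Y :: "'w \<Rightarrow> real"
      using variance_positive[of Y] variance_eq[OF that] by simp
    then show "\<exists>N. \<forall>k\<ge>N. (expectation (grid_sum (tilt W c (t / real k)) t k))\<^sup>2
        \<le> expectation (\<lambda>\<omega>. (grid_sum (tilt W c (t / real k)) t k \<omega>)\<^sup>2)"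
      using integrable_grid_sum[OF t] expectation_grid_sum_square(1)[OF t] by blast
  qed
  then show ?thesis unfolding m flux_tilt[of W c, OF W] by (simp add: algebra_simps)
qed

end

subsection \<open>Jumps of regular paths\<close>

text \<open>The value \<open>c\<close> is the left limit in the discrete topology, so these are the
  times at which \<open>R\<close> relates the state just before to the state at that time.\<close>

definition transitions :: "(real \<Rightarrow> 's) \<Rightarrow> ('s \<Rightarrow> 's \<Rightarrow> bool) \<Rightarrow> real set" where
  "transitions \<xi> R = {u. \<exists>c. (\<forall>\<^sub>F v in at_left u. \<xi> v = c) \<and> R c (\<xi> u)}"

lemma transitions_iff:
  assumes "l < u" and "\<And>v. l < v \<Longrightarrow> v < u \<Longrightarrow> \<xi> v = c"
  shows "u \<in> transitions \<xi> R \<longleftrightarrow> R c (\<xi> u)"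
proof -
  have c: "\<forall>\<^sub>F v in at_left u. \<xi> v = c"
    using assms by (auto simp: eventually_at_left_field)
  have "c' = c" if "\<forall>\<^sub>F v in at_left u. \<xi> v = c'" for c'
  proof -
    have "\<forall>\<^sub>F v in at_left u. c' = c" using that c by eventually_elim simp
    then show ?thesis by (simp add: trivial_limit_at_left_real)
  qed
  with c show ?thesis unfolding transitions_def mem_Collect_eq by metis
qed

text \<open>Around each time the path is constant on either side within some radius. A Lebesgue
  number of this cover of [0, t] puts every short interval into one such neighbourhood, where at
  most its centre is a transition; comparing the endpoints then detects it. Irreflexivity of
  \<open>R\<close> excludes transitions on constant pieces.\<close>

lemma regular_path_mesh:
  fixes \<xi> :: "real \<Rightarrow> 's"
  assumes right: "\<And>u. 0 \<le> u \<Longrightarrow> \<forall>\<^sub>F v in at_right u. \<xi> v = \<xi> u"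
    and left: "\<And>u. 0 < u \<Longrightarrow> \<exists>s. \<forall>\<^sub>F v in at_left u. \<xi> v = s"
    and R: "\<And>s. \<not> R s s"
  obtains e where "e > 0" and "\<And>a b. 0 \<le> a \<Longrightarrow> a < b \<Longrightarrow> b \<le> t \<Longrightarrow> b - a < e \<Longrightarrow>
    finite (transitions \<xi> R \<inter> {a<..b}) \<and> card (transitions \<xi> R \<inter> {a<..b}) = of_bool (R (\<xi> a) (\<xi> b))"
proof -
  \<comment> \<open>\<open>ec\<close> pairs a radius with the constant value on the left of
    \<open>u\<close>.\<close>
  define near where "near u ec \<longleftrightarrow> 0 < fst ec \<and> (\<forall>v. 0 \<le> v \<and> u - fst ec < v \<and> v < u \<longrightarrow> \<xi> v = snd ec)
    \<and> (\<forall>v. u \<le> v \<and> v < u + fst ec \<longrightarrow> \<xi> v = \<xi> u)" for u ec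
  have "\<exists>ec. near u ec" if "u \<in> {0..t}" for u
  proof -
    obtain b where b: "b > u" "\<And>v. v > u \<Longrightarrow> v < b \<Longrightarrow> \<xi> v = \<xi> u"
      using right[of u] \<open>u \<in> {0..t}\<close> by (auto simp: eventually_at_right_field)
    obtain a c where a: "a < u" "\<And>v. 0 \<le> v \<Longrightarrow> v > a \<Longrightarrow> v < u \<Longrightarrow> \<xi> v = c"
    proof (cases "u = 0")
      case True
      \<comment> \<open>At time 0 the left condition is vacuous, as \<open>near\<close> restricts to
        \<open>0 \<le> v\<close>.\<close>
      then show ?thesis using that[of "-1" "\<xi> 0"] by auto
    next
      case False
      then show ?thesis using left[of u] \<open>u \<in> {0..t}\<close> that by (auto simp: eventually_at_left_field)
    qed
    show ?thesis
      unfolding near_def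
    proof (intro exI[of _ "(min (u - a) (b - u), c)"] conjI allI impI; unfold fst_conv snd_conv)
      show "0 < min (u - a) (b - u)" using a b by simp
      show "\<xi> v = c" if "0 \<le> v \<and> u - min (u - a) (b - u) < v \<and> v < u" for v
        using that by (intro a) auto
      show "\<xi> v = \<xi> u" if "u \<le> v \<and> v < u + min (u - a) (b - u)" for v
        using that b(2)[of v] by (cases "u = v") auto
    qed
  qed
  then have "\<forall>u\<in>{0..t}. \<exists>ec. near u ec" by blast
  from bchoice[OF this] obtain ec where ec: "\<forall>u\<in>{0..t}. near u (ec u)" ..
  define e where "e u = fst (ec u)" for u
  define c where "c u = snd (ec u)" for u
  have e: "0 < e u" and c: "\<And>v. 0 \<le> v \<Longrightarrow> u - e u < v \<Longrightarrow> v < u \<Longrightarrow> \<xi> v = c u"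
    and d: "\<And>v. u \<le> v \<Longrightarrow> v < u + e u \<Longrightarrow> \<xi> v = \<xi> u" if "u \<in> {0..t}" for u
    using ec that unfolding near_def e_def c_def by blast+
  have cover: "{0..t} \<subseteq> (\<Union>u\<in>{0..t}. ball u (e u))" using e by force
  have op: "open G" if "G \<in> (\<lambda>u. ball u (e u)) ` {0..t}" for G using that by auto
  obtain \<epsilon> where \<epsilon>: "0 < \<epsilon>" "\<And>x. x \<in> {0..t} \<Longrightarrow> \<exists>G \<in> (\<lambda>u. ball u (e u)) ` {0..t}. ball x \<epsilon> \<subseteq> G"
    by (rule Heine_Borel_lemma[OF compact_Icc cover op]) (assumption, rule that)
  show ?thesis
  proof (rule that[OF \<epsilon>(1)])
    fix a b assume ab: "0 \<le> a" "a < b" "b \<le> t" "b - a < \<epsilon>"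
    obtain u where u: "u \<in> {0..t}" "ball a \<epsilon> \<subseteq> ball u (e u)"
      using \<epsilon>(2)[of a] ab by auto
    have in_ball: "u - e u < v \<and> v < u + e u" if "a \<le> v" "v \<le> b" for v
    proof -
      have "v \<in> ball a \<epsilon>" using that ab by (simp add: dist_real_def)
      then have "v \<in> ball u (e u)" using u by blast
      then show ?thesis by (simp add: dist_real_def abs_less_iff)
    qed
    \<comment> \<open>Before the centre \<open>u\<close> the path equals \<open>c u\<close>, from
      \<open>u\<close> on it equals \<open>\<xi> u\<close>; so \<open>u\<close> is the one candidate
      for a transition.\<close>
    have iff: "v \<in> transitions \<xi> R \<longleftrightarrow> v = u \<and> R (c u) (\<xi> u)" if "a < v" "v \<le> b" for v
    proof (cases v u rule: linorder_cases)
      case less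
      have "v \<in> transitions \<xi> R \<longleftrightarrow> R (c u) (\<xi> v)"
      proof (rule transitions_iff[OF \<open>a < v\<close>])
        fix w assume "a < w" "w < v"
        then show "\<xi> w = c u" using u(1) ab less in_ball[of w] that by (intro c) auto
      qed
      moreover have "\<xi> v = c u" using u(1) ab less in_ball[of v] that by (intro c) auto
      ultimately show ?thesis using less R by auto
    next
      case equal
      have "v \<in> transitions \<xi> R \<longleftrightarrow> R (c u) (\<xi> v)"
      proof (rule transitions_iff[OF \<open>a < v\<close>])
        fix w assume "a < w" "w < v"
        then show "\<xi> w = c u" using u(1) ab equal in_ball[of w] that by (intro c) auto
      qed
      then show ?thesis using equal by simp
    next
      case greater
      have "v \<in> transitions \<xi> R \<longleftrightarrow> R (\<xi> u) (\<xi> v)"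
      proof (rule transitions_iff[of "max a u"])
        fix w assume "max a u < w" "w < v"
        then show "\<xi> w = \<xi> u" using u(1) ab greater in_ball[of w] that by (intro d) auto
      qed (use that greater in auto)
      moreover have "\<xi> v = \<xi> u" using u(1) ab greater in_ball[of v] that by (intro d) auto
      ultimately show ?thesis using greater R by auto
    qed
    show "finite (transitions \<xi> R \<inter> {a<..b}) \<and> card (transitions \<xi> R \<inter> {a<..b}) = of_bool (R (\<xi> a) (\<xi> b))"
    proof (cases "a < u \<and> u \<le> b")
      case True
      have "\<xi> a = c u" using u(1) ab True in_ball[of a] by (intro c) auto
      moreover have "\<xi> b = \<xi> u" using u(1) ab True in_ball[of b] by (intro d) auto
      moreover have "transitions \<xi> R \<inter> {a<..b} = (if R (c u) (\<xi> u) then {u} else {})"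
        using iff True by auto
      ultimately show ?thesis by auto
    next
      case False
      have "\<xi> a = \<xi> b"
      proof (cases "u \<le> a")
        case True
        have "\<xi> a = \<xi> u" "\<xi> b = \<xi> u"
          using u(1) ab True in_ball[of a] in_ball[of b] by (intro d; auto)+
        then show ?thesis by simp
      next
        case nle: False
        have "\<xi> a = c u" "\<xi> b = c u"
          using u(1) ab nle False in_ball[of a] in_ball[of b] by (intro c; auto)+
        then show ?thesis by simp
      qed
      moreover have "transitions \<xi> R \<inter> {a<..b} = {}" using iff False by auto
      ultimately show ?thesis using R by simp
    qed
  qed
qed

text \<open>Once the mesh is below the threshold \<open>e\<close>, every cell counts its transitions
  exactly, and the half-open cells partition \<open>{0<..t}\<close>.\<close>

lemma card_transitions_eventually:
  fixes \<xi> :: "real \<Rightarrow> 's"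
  assumes right: "\<And>u. 0 \<le> u \<Longrightarrow> \<forall>\<^sub>F v in at_right u. \<xi> v = \<xi> u"
    and left: "\<And>u. 0 < u \<Longrightarrow> \<exists>s. \<forall>\<^sub>F v in at_left u. \<xi> v = s"
    and R: "\<And>s. \<not> R s s" and t: "t > 0"
  shows "\<forall>\<^sub>F k in sequentially.
    (\<Sum>j<k. of_bool (R (\<xi> (t * real j / real k)) (\<xi> (t * real (Suc j) / real k))))
      = card (transitions \<xi> R \<inter> {0<..t})"
proof -
  obtain e where "e > 0" and e: "\<And>a b. 0 \<le> a \<Longrightarrow> a < b \<Longrightarrow> b \<le> t \<Longrightarrow> b - a < e \<Longrightarrow>
    finite (transitions \<xi> R \<inter> {a<..b}) \<and> card (transitions \<xi> R \<inter> {a<..b}) = of_bool (R (\<xi> a) (\<xi> b))"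
    by (rule regular_path_mesh[where \<xi> = \<xi> and R = R and t = t, OF right left R]) (assumption+, rule that)
  have "(\<lambda>k. t / real k) \<longlonglongrightarrow> 0" by (rule lim_const_over_n)
  then have "\<forall>\<^sub>F k in sequentially. t / real k < e" using \<open>e > 0\<close> by (rule order_tendstoD)
  then show ?thesis using eventually_gt_at_top[of 0]
  proof eventually_elim
    case (elim k)
    define x where "x j = t * real j / real k" for j
    have le: "x j \<le> t" if "j \<le> k" for j
    proof -
      have "t * real j \<le> t * real k" using that t by (intro mult_left_mono) auto
      then show ?thesis using elim by (simp add: x_def divide_le_eq)
    qed
    have "finite (transitions \<xi> R \<inter> {0<..x m}) \<and>
      (\<Sum>j<m. of_bool (R (\<xi> (x j)) (\<xi> (x (Suc j))))) = card (transitions \<xi> R \<inter> {0<..x m})" if "m \<le> k" for m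
      using that
    proof (induction m)
      case (Suc m)
      have d: "x (Suc m) - x m = t / real k" by (simp add: x_def algebra_simps add_divide_distrib)
      then have lt: "x m < x (Suc m)" using t elim divide_pos_pos[of t "real k"] by linarith
      have x0: "0 \<le> x m" using t by (simp add: x_def)
      have split: "transitions \<xi> R \<inter> {0<..x (Suc m)}
        = (transitions \<xi> R \<inter> {0<..x m}) \<union> (transitions \<xi> R \<inter> {x m<..x (Suc m)})"
        using lt x0 by auto
      have cell: "finite (transitions \<xi> R \<inter> {x m<..x (Suc m)}) \<and>
        card (transitions \<xi> R \<inter> {x m<..x (Suc m)}) = of_bool (R (\<xi> (x m)) (\<xi> (x (Suc m))))"
        using Suc.prems d elim by (intro e x0 lt le) auto
      have "card (transitions \<xi> R \<inter> {0<..x (Suc m)})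
        = card (transitions \<xi> R \<inter> {0<..x m}) + card (transitions \<xi> R \<inter> {x m<..x (Suc m)})"
        unfolding split using Suc cell by (intro card_Un_disjoint) auto
      then show ?case unfolding split using Suc cell by auto
    qed (simp add: x_def)
    from this[of k] show ?case using elim by (simp add: x_def)
  qed
qed

section \<open>From grid sums to the moments of the current\<close>

context stationary_jump_process
begin

lemma grid_sum_nonneg: "(\<And>s s'. F s s' \<ge> 0) \<Longrightarrow> grid_sum F t k \<omega> \<ge> 0"
  unfolding grid_sum_def by (rule sum_nonneg) auto

text \<open>If the endpoints of a cell differ, its midpoint differs from at least one of them, so
  halving the mesh loses no change.\<close>

lemma grid_sum_changes_double:
  "grid_sum (\<lambda>s s'. of_bool (s \<noteq> s')) t k \<omega> \<le> grid_sum (\<lambda>s s'. of_bool (s \<noteq> s')) t (2 * k) \<omega>"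
proof (cases "k = 0")
  case False
  define y where "y j = X (t * real j / real (2 * k)) \<omega>" for j
  have y: "X (t * real j / real k) \<omega> = y (2 * j)" for j by (simp add: y_def)
  have pairs: "(\<Sum>j<2 * k. z j) = (\<Sum>j<k. z (2 * j) + z (Suc (2 * j)))" for z :: "nat \<Rightarrow> real" and k
    by (induction k) (simp_all add: algebra_simps)
  have "(\<Sum>j<k. of_bool (y (2 * j) \<noteq> y (2 * Suc j)))
    \<le> (\<Sum>j<k. of_bool (y (2 * j) \<noteq> y (Suc (2 * j))) + of_bool (y (Suc (2 * j)) \<noteq> y (Suc (Suc (2 * j)))) :: real)"
    by (rule sum_mono) auto
  also have "\<dots> = (\<Sum>j<2 * k. of_bool (y j \<noteq> y (Suc j)))"
    by (simp add: pairs)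
  finally show ?thesis by (simp only: grid_sum_def y) (simp only: y_def)
qed (simp add: grid_sum_def)

text \<open>Along the meshes \<open>t / 2 ^ n\<close> the observed number of changes increases to
  the total number \<open>K\<close> of jumps. Convergence of its second moments makes
  \<open>K\<close> square integrable, and a multiple of \<open>K\<close> dominates all grid sums of
  \<open>W\<close>, so their moments converge to those of \<open>N\<close>.\<close>

lemma current_moments:
  assumes t: "t > 0" and W: "\<And>s. W s s = 0"
    and N: "\<And>\<omega>. \<omega> \<in> space M \<Longrightarrow> \<forall>\<^sub>F k in sequentially. grid_sum W t k \<omega> = N \<omega>"
    and lim: "(\<lambda>k. expectation (\<lambda>\<omega>. (grid_sum W t k \<omega>)\<^sup>2)) \<longlonglongrightarrow> m"
  shows "integrable M N" and "integrable M (\<lambda>\<omega>. (N \<omega>)\<^sup>2)"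
    and "expectation N = t * flux W" and "expectation (\<lambda>\<omega>. (N \<omega>)\<^sup>2) = m"
proof -
  define ch where "ch = (\<lambda>s s' :: 's. of_bool (s \<noteq> s') :: real)"
  define D where "D n = grid_sum ch t (2 ^ n)" for n
  define K where "K \<omega> = real (card (transitions (\<lambda>u. X u \<omega>) (\<noteq>) \<inter> {0<..t}))" for \<omega>
  define C where "C = (\<Sum>s\<in>UNIV. \<Sum>s'\<in>UNIV. \<bar>W s s'\<bar>)"
  have dyadic: "filterlim (\<lambda>n. 2 ^ n :: nat) at_top sequentially"
    by (rule filterlim_subseq) (simp add: strict_mono_def)
  have N': "\<forall>\<^sub>F n in sequentially. grid_sum W t (2 ^ n) \<omega> = N \<omega>" if "\<omega> \<in> space M" for \<omega>
    by (rule eventually_compose_filterlim[OF N[OF that] dyadic])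
  have "\<forall>\<^sub>F k in sequentially. grid_sum ch t k \<omega> = K \<omega>" if "\<omega> \<in> space M" for \<omega>
  proof -
    have "\<forall>\<^sub>F k in sequentially.
      (\<Sum>j<k. of_bool (X (t * real j / real k) \<omega> \<noteq> X (t * real (Suc j) / real k) \<omega>))
        = card (transitions (\<lambda>u. X u \<omega>) (\<noteq>) \<inter> {0<..t})"
      by (rule card_transitions_eventually[OF right_continuous[OF that] left_limits[OF that] _ t]) simp_all
    then show ?thesis
    proof eventually_elim
      case (elim k)
      show ?case unfolding K_def elim[symmetric] by (simp add: grid_sum_def ch_def)
    qed
  qed
  then have K: "\<forall>\<^sub>F n in sequentially. D n \<omega> = K \<omega>" if "\<omega> \<in> space M" for \<omega>
    unfolding D_def by (rule eventually_compose_filterlim[OF _ dyadic]) (use that in auto)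
  have D0: "D n \<omega> \<ge> 0" for n \<omega> unfolding D_def by (rule grid_sum_nonneg) (simp add: ch_def)
  have Dmono: "incseq (\<lambda>n. D n \<omega>)" for \<omega>
    by (rule incseq_SucI) (use grid_sum_changes_double[of t "2 ^ _" \<omega>] in \<open>simp add: D_def ch_def\<close>)
  have DK: "D n \<omega> \<le> K \<omega>" if "\<omega> \<in> space M" for n \<omega>
    by (rule incseq_le[OF Dmono tendsto_eventually[OF K[OF that]]])
  have [measurable]: "D n \<in> borel_measurable M" for n
    using integrable_grid_sum[OF t] unfolding D_def by auto
  have Kmeas [measurable]: "K \<in> borel_measurable M"
    by (rule borel_measurable_LIMSEQ_metric[of D]) (use tendsto_eventually[OF K] in auto)
  obtain f0 g g0 h where f: "app (generator r) f0 = (\<lambda>_. 0)" "\<And>s. drift ch s = f0 s + app (generator r) g s"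
    and g: "app (generator r) g0 = (\<lambda>_. 0)" "\<And>s. g s = g0 s + app (generator r) h s"
    by (rule harmonic_decomposition_twice[where f = "drift ch"]) blast
  obtain mK where "(\<lambda>k. expectation (\<lambda>\<omega>. (grid_sum ch t k \<omega>)\<^sup>2)) \<longlonglongrightarrow> mK"
    using expectation_grid_sum_square_tendsto[OF t _ f g, of 0] by (auto simp: ch_def)
  then have mK: "(\<lambda>n. expectation (\<lambda>\<omega>. (D n \<omega>)\<^sup>2)) \<longlonglongrightarrow> mK"
    unfolding D_def by (rule filterlim_compose[OF _ dyadic])
  \<comment> \<open>Monotone convergence: the integrals of the squares of \<open>D n\<close> tend to
    the finite limit \<open>mK\<close>, obtained from the second moment formula for the weights
    \<open>ch\<close>.\<close>
  have K2: "integrable M (\<lambda>\<omega>. (K \<omega>)\<^sup>2)"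
  proof (rule integrable_monotone_convergence[OF _ _ _ mK])
    show "integrable M (\<lambda>\<omega>. (D n \<omega>)\<^sup>2)" for n
      unfolding D_def by (rule expectation_grid_sum_square(1)[OF t])
    show "AE \<omega> in M. mono (\<lambda>n. (D n \<omega>)\<^sup>2)"
      using Dmono D0 by (auto intro!: AE_I2 monoI power_mono dest: incseqD)
    show "AE \<omega> in M. (\<lambda>n. (D n \<omega>)\<^sup>2) \<longlonglongrightarrow> (K \<omega>)\<^sup>2"
      using tendsto_eventually[OF K] by (auto intro!: AE_I2 tendsto_power)
  qed simp
  have Kint: "integrable M K" using K2 by (rule square_integrable_imp_integrable[rotated]) simp
  have W_le: "\<bar>W s s'\<bar> \<le> C * ch s s'" for s s'
  proof (cases "s = s'")
    case False
    have "\<bar>W s s'\<bar> \<le> (\<Sum>s'\<in>UNIV. \<bar>W s s'\<bar>)" by (rule member_le_sum) auto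
    also have "\<dots> \<le> C" unfolding C_def
      by (rule member_le_sum[where f = "\<lambda>s. \<Sum>s'\<in>UNIV. \<bar>W s s'\<bar>"]) (auto intro: sum_nonneg)
    finally show ?thesis using False by (simp add: ch_def)
  qed (simp add: W ch_def)
  have dom: "\<bar>grid_sum W t (2 ^ n) \<omega>\<bar> \<le> C * K \<omega>" if "\<omega> \<in> space M" for n \<omega>
  proof -
    have "\<bar>grid_sum W t (2 ^ n) \<omega>\<bar> \<le> C * D n \<omega>"
      unfolding grid_sum_def D_def sum_distrib_left
      by (rule order_trans[OF sum_abs sum_mono]) (rule W_le)
    also have "\<dots> \<le> C * K \<omega>"
      using DK[OF that] by (intro mult_left_mono) (auto simp: C_def intro!: sum_nonneg)
    finally show ?thesis .
  qed
  have gm [measurable]: "grid_sum W t k \<in> borel_measurable M" for k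
    using integrable_grid_sum[OF t] by auto
  have [measurable]: "N \<in> borel_measurable M"
    by (rule borel_measurable_LIMSEQ_metric[of "\<lambda>n. grid_sum W t (2 ^ n)"])
       (use tendsto_eventually[OF N'] in auto)
  have d1: "AE \<omega> in M. (\<lambda>n. grid_sum W t (2 ^ n) \<omega>) \<longlonglongrightarrow> N \<omega>"
    using tendsto_eventually[OF N'] by (auto intro!: AE_I2)
  have b1: "AE \<omega> in M. norm (grid_sum W t (2 ^ n) \<omega>) \<le> C * K \<omega>" for n
    using dom by auto
  have b2: "AE \<omega> in M. norm ((grid_sum W t (2 ^ n) \<omega>)\<^sup>2) \<le> C\<^sup>2 * (K \<omega>)\<^sup>2" for n
  proof (rule AE_I2)
    fix \<omega> assume "\<omega> \<in> space M"
    from power_mono[OF dom[OF this, of n], of 2]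
    show "norm ((grid_sum W t (2 ^ n) \<omega>)\<^sup>2) \<le> C\<^sup>2 * (K \<omega>)\<^sup>2" by (simp add: power_mult_distrib)
  qed
  have d2: "AE \<omega> in M. (\<lambda>n. (grid_sum W t (2 ^ n) \<omega>)\<^sup>2) \<longlonglongrightarrow> (N \<omega>)\<^sup>2"
    using d1 by eventually_elim (rule tendsto_power)
  show "integrable M N"
    by (rule integrable_dominated_convergence[OF _ _ _ d1 b1]) (use Kint in auto)
  show "integrable M (\<lambda>\<omega>. (N \<omega>)\<^sup>2)"
    by (rule integrable_dominated_convergence[OF _ _ _ d2 b2]) (use K2 in auto)
  have "(\<lambda>n. expectation (\<lambda>\<omega>. grid_sum W t (2 ^ n) \<omega>)) \<longlonglongrightarrow> expectation N"
    by (rule integral_dominated_convergence[OF _ _ _ d1 b1]) (use Kint in auto)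
  moreover have "(\<lambda>n. expectation (grid_sum W t (2 ^ n))) \<longlonglongrightarrow> t * flux W"
    using filterlim_compose[OF expectation_grid_sum_tendsto[where W = W and c = 0, OF t W] dyadic] by simp
  ultimately show "expectation N = t * flux W" by (rule LIMSEQ_unique)
  have "(\<lambda>n. expectation (\<lambda>\<omega>. (grid_sum W t (2 ^ n) \<omega>)\<^sup>2)) \<longlonglongrightarrow> expectation (\<lambda>\<omega>. (N \<omega>)\<^sup>2)"
    by (rule integral_dominated_convergence[OF _ _ _ d2 b2]) (use K2 in auto)
  moreover have "(\<lambda>n. expectation (\<lambda>\<omega>. (grid_sum W t (2 ^ n) \<omega>)\<^sup>2)) \<longlonglongrightarrow> m"
    by (rule filterlim_compose[OF lim dyadic])
  ultimately show "expectation (\<lambda>\<omega>. (N \<omega>)\<^sup>2) = m" by (rule LIMSEQ_unique)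
qed

end

subsection \<open>The kinetic uncertainty relation\<close>

context stationary_jump_process
begin

lemma activity_nonneg: "activity \<ge> 0"
proof -
  have nonneg: "generator r s s' * of_bool (s \<noteq> s') \<ge> 0" for s s'
    by (cases "s = s'") (auto simp: generator_offdiag rate_nonneg)
  then show ?thesis
    unfolding activity_def flux_def influx_def by (intro sum_nonneg mult_nonneg_nonneg[OF pmf_nonneg nonneg])
qed

text \<open>The remainder is bounded because \<open>P t\<close> enters it only through
  \<open>app (P t) h\<close>. For a reducible chain the quadratic coefficient
  \<open>\<alpha>\<close> need not vanish: the long-run current may depend on the initial
  state.\<close>

lemma variance_current:
  assumes W: "\<And>s. W s s = 0"
    and N: "\<And>t \<omega>. t > 0 \<Longrightarrow> \<omega> \<in> space M \<Longrightarrow> \<forall>\<^sub>F k in sequentially. grid_sum W t k \<omega> = N t \<omega>"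
  obtains \<alpha> \<beta> \<gamma> C where
    "\<And>t. t > 0 \<Longrightarrow> variance (N t) = \<alpha> * t\<^sup>2 + \<beta> * t + \<gamma> t" and "\<And>t. t > 0 \<Longrightarrow> \<bar>\<gamma> t\<bar> \<le> C"
proof -
  obtain f0 g g0 h where f: "app (generator r) f0 = (\<lambda>_. 0)" "\<And>s. drift W s = f0 s + app (generator r) g s"
    and g: "app (generator r) g0 = (\<lambda>_. 0)" "\<And>s. g s = g0 s + app (generator r) h s"
    by (rule harmonic_decomposition_twice[where f = "drift W"]) blast
  define q where "q = influx W"
  define \<gamma> where "\<gamma> t = 2 * (pair q (app (P t) h) - pair q h)" for t
  define \<alpha> where "\<alpha> = pair q f0 - (flux W)\<^sup>2"
  define \<beta> where "\<beta> = flux (\<lambda>s s'. of_bool (s \<noteq> s') * (W s s' + 0)\<^sup>2) + 2 * (pair q g0 - pair q g)"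
  show ?thesis
  proof (rule that)
    fix t :: real assume t: "t > 0"
    note mom = current_moments[OF t W N[OF t] expectation_grid_sum_square_tendsto[OF t W f g, of 0, unfolded tilt_0]]
    have "variance (N t) = expectation (\<lambda>\<omega>. (N t \<omega>)\<^sup>2) - (expectation (N t))\<^sup>2"
      by (rule variance_eq[OF mom(1,2)])
    then show "variance (N t) = \<alpha> * t\<^sup>2 + \<beta> * t + \<gamma> t"
      by (simp add: mom(3,4) \<alpha>_def \<beta>_def \<gamma>_def q_def power_mult_distrib algebra_simps)
    show "\<bar>\<gamma> t\<bar> \<le> 2 * ((\<Sum>s\<in>UNIV. \<bar>q s\<bar>) * (\<Sum>s\<in>UNIV. \<bar>h s\<bar>) + \<bar>pair q h\<bar>)"
      using abs_pair_app_P_le[of t q h] t by (simp add: \<gamma>_def abs_mult)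
  qed
qed

lemma expectation_current:
  assumes W: "\<And>s. W s s = 0" and t: "t > 0"
    and N: "\<And>\<omega>. \<omega> \<in> space M \<Longrightarrow> \<forall>\<^sub>F k in sequentially. grid_sum W t k \<omega> = N \<omega>"
  shows "expectation N = t * flux W"
    and "0 \<le> variance N + t * (2 * c * flux W + c\<^sup>2 * activity)"
proof -
  obtain f0 g g0 h where f: "app (generator r) f0 = (\<lambda>_. 0)" "\<And>s. drift W s = f0 s + app (generator r) g s"
    and g: "app (generator r) g0 = (\<lambda>_. 0)" "\<And>s. g s = g0 s + app (generator r) h s"
    by (rule harmonic_decomposition_twice[where f = "drift W"]) blast
  note lim = expectation_grid_sum_square_tendsto[OF t W f g, of 0, unfolded tilt_0]
  note mom = current_moments[OF t W N lim]
  show exp: "expectation N = t * flux W" by (rule mom(3))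
  have "variance N = expectation (\<lambda>\<omega>. (N \<omega>)\<^sup>2) - (expectation N)\<^sup>2" by (rule variance_eq[OF mom(1,2)])
  moreover have "0 \<le> expectation (\<lambda>\<omega>. (N \<omega>)\<^sup>2) - (expectation N)\<^sup>2 + t * (2 * c * flux W + c\<^sup>2 * activity)"
    using second_moment_bound[OF t W lim, of c] by (simp only: exp mom(4))
  ultimately show "0 \<le> variance N + t * (2 * c * flux W + c\<^sup>2 * activity)" by simp
qed

text \<open>\<open>asymptotic_snr\<close> is a \<open>Lim\<close>, which carries information only
  when the limit exists; therefore convergence is proved along with the bound.\<close>

theorem kinetic_uncertainty_relation:
  assumes W: "\<And>s. W s s = 0"
    and N: "\<And>t \<omega>. t > 0 \<Longrightarrow> \<omega> \<in> space M \<Longrightarrow> \<forall>\<^sub>F k in sequentially. grid_sum W t k \<omega> = N t \<omega>"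
  shows "(snr M N \<longlongrightarrow> asymptotic_snr M N) at_top \<and> asymptotic_snr M N \<le> ereal activity"
proof -
  define J where "J = flux W"
  define v where "v t = variance (N t) / t" for t
  have exp: "expectation (N t) = t * J" if "t > 0" for t
    unfolding J_def by (rule expectation_current(1)[OF W that N[OF that]])
  \<comment> \<open>The mean is known to be linear for positive times, which contain a neighbourhood
    of \<open>t\<close>, and that is enough for the derivative.\<close>
  have snr: "snr M N t = ereal (J\<^sup>2) / ereal (v t)" if "t > 0" for t
  proof -
    have "\<forall>\<^sub>F \<tau> in nhds t. expectation (N \<tau>) = \<tau> * J"
      using eventually_nhds_in_open[of "{0<..}" t] that by (auto elim!: eventually_mono simp: exp)
    then have "deriv (\<lambda>\<tau>. expectation (N \<tau>)) t = deriv (\<lambda>\<tau>. \<tau> * J) t"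
      by (rule deriv_cong_ev) simp
    also have "\<dots> = J" by (rule DERIV_imp_deriv) (auto intro!: derivative_eq_intros)
    finally show ?thesis by (simp add: snr_def v_def)
  qed
  have v_bound: "0 \<le> v t + (2 * c * J + c\<^sup>2 * activity)" if "t > 0" for t c
  proof -
    have "0 \<le> (variance (N t) + t * (2 * c * J + c\<^sup>2 * activity)) / t"
      using expectation_current(2)[OF W that N[OF that], of c] that by (simp add: J_def)
    then show ?thesis using that by (simp add: v_def add_divide_distrib)
  qed
  have "\<exists>L. (snr M N \<longlongrightarrow> ereal L) at_top \<and> L \<le> activity"
  proof (cases "J = 0")
    case True
    \<comment> \<open>With zero numerator the quotient is 0 even at vanishing variance, since
      \<open>0 / 0 = 0\<close> in \<open>ereal\<close>.\<close>
    have "(snr M N \<longlongrightarrow> ereal 0) at_top"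
      by (rule tendsto_eventually, rule eventually_mono[OF eventually_gt_at_top[of 0]])
         (simp add: snr True zero_ereal_def[symmetric])
    then show ?thesis using activity_nonneg by blast
  next
    case False
    have "activity > 0"
    proof (rule ccontr)
      assume "\<not> activity > 0"
      then have "activity = 0" using activity_nonneg by simp
      \<comment> \<open>Without activity the lower bound is linear in \<open>c\<close>; this
        \<open>c\<close> turns its right-hand side into -1.\<close>
      then show False using v_bound[of 1 "- (v 1 + 1) / (2 * J)"] False by (simp add: field_simps)
    qed
    \<comment> \<open>\<open>c = - J / activity\<close> minimises
      \<open>2 * c * J + c\<^sup>2 * activity\<close>.\<close>
    have v_ge: "J\<^sup>2 / activity \<le> v t" if "t > 0" for t
      using v_bound[OF that, of "- J / activity"] \<open>activity > 0\<close>
      by (simp add: power2_eq_square field_simps)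
    have pos: "J\<^sup>2 / activity > 0" using False \<open>activity > 0\<close> by simp
    define s where "s t = J\<^sup>2 / v t" for t
    have snr_s: "snr M N t = ereal (s t)" if "t > 0" for t
      using v_ge[OF that] pos by (simp add: snr[OF that] s_def)
    have s_le: "s t \<le> activity" if "t > 0" for t
    proof -
      have "v t > 0" using v_ge[OF that] pos by linarith
      then show ?thesis using v_ge[OF that] \<open>activity > 0\<close> by (simp add: s_def field_simps)
    qed
    obtain \<alpha> \<beta> \<gamma> C where var: "\<And>t. t > 0 \<Longrightarrow> variance (N t) = \<alpha> * t\<^sup>2 + \<beta> * t + \<gamma> t"
      and \<gamma>: "\<And>t. t > 0 \<Longrightarrow> \<bar>\<gamma> t\<bar> \<le> C"
      using variance_current[where W = W and N = N, OF W N] by blast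
    have v_eq: "v t = \<alpha> * t + \<beta> + \<gamma> t / t" if "t > 0" for t
      unfolding v_def var[OF that] using that by (simp add: add_divide_distrib power2_eq_square)
    have "((\<lambda>t. \<gamma> t / t) \<longlongrightarrow> 0) at_top"
    proof (rule Lim_null_comparison)
      show "\<forall>\<^sub>F t in at_top. norm (\<gamma> t / t) \<le> C / t"
        by (rule eventually_mono[OF eventually_gt_at_top[of 0]]) (simp add: abs_divide \<gamma> divide_right_mono)
      show "((\<lambda>t. C / t) \<longlongrightarrow> 0) at_top"
        by (rule real_tendsto_divide_at_top[OF tendsto_const filterlim_ident])
    qed
    then have rest: "((\<lambda>t. \<beta> + \<gamma> t / t) \<longlongrightarrow> \<beta>) at_top"
      using tendsto_add[OF tendsto_const[of \<beta>]] by fastforce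
    have ev_v: "\<forall>\<^sub>F t in at_top. \<alpha> * t + (\<beta> + \<gamma> t / t) = v t"
      by (rule eventually_mono[OF eventually_gt_at_top[of 0]]) (simp add: v_eq)
    \<comment> \<open>The sign of \<open>\<alpha>\<close> decides: a negative one would drive
      \<open>v\<close> below its positive lower bound, zero gives \<open>v\<close> the positive
      limit \<open>\<beta>\<close>, and a positive one sends \<open>v\<close> to infinity and
      \<open>s\<close> to 0.\<close>
    have "\<exists>L. (s \<longlongrightarrow> L) at_top"
    proof (cases \<alpha> "0 :: real" rule: linorder_cases)
      case less
      have "filterlim (\<lambda>t. - \<alpha> * t) at_top at_top"
        by (rule filterlim_tendsto_pos_mult_at_top[OF tendsto_const _ filterlim_ident]) (use less in simp)
      then have "filterlim (\<lambda>t. - (\<beta> + \<gamma> t / t) + - \<alpha> * t) at_top at_top"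
        by (rule filterlim_tendsto_add_at_top[OF tendsto_minus[OF rest]])
      then have "\<forall>\<^sub>F t in at_top. 0 < - (\<beta> + \<gamma> t / t) + - \<alpha> * t"
        by (simp only: filterlim_at_top_dense)
      then have "\<forall>\<^sub>F t :: real in at_top. False"
        using ev_v eventually_gt_at_top[of 0]
        by eventually_elim (use v_ge pos in \<open>force simp: add_ac\<close>)
      then show ?thesis by (simp add: eventually_False)
    next
      case equal
      then have v: "(v \<longlongrightarrow> \<beta>) at_top"
        using Lim_transform_eventually[OF rest, of v] ev_v by simp
      have "J\<^sup>2 / activity \<le> \<beta>"
        by (rule tendsto_lowerbound[OF v])
           (auto intro: eventually_mono[OF eventually_gt_at_top[of 0]] v_ge)
      then have "(s \<longlongrightarrow> J\<^sup>2 / \<beta>) at_top"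
        unfolding s_def[abs_def] using pos by (intro tendsto_intros v) auto
      then show ?thesis by blast
    next
      case greater
      have "filterlim (\<lambda>t. \<alpha> * t) at_top at_top"
        by (rule filterlim_tendsto_pos_mult_at_top[OF tendsto_const greater filterlim_ident])
      then have "filterlim (\<lambda>t. (\<beta> + \<gamma> t / t) + \<alpha> * t) at_top at_top"
        by (rule filterlim_tendsto_add_at_top[OF rest])
      then have "filterlim v at_top at_top"
        by (rule filterlim_cong[THEN iffD1, rotated -1]) (use ev_v in \<open>simp_all add: add_ac\<close>)
      then have "(s \<longlongrightarrow> 0) at_top"
        unfolding s_def[abs_def] by (rule real_tendsto_divide_at_top[OF tendsto_const])
      then show ?thesis by blast
    qed
    then obtain L where L: "(s \<longlongrightarrow> L) at_top" by blast
    have "L \<le> activity"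
      by (rule tendsto_upperbound[OF L])
         (auto intro: eventually_mono[OF eventually_gt_at_top[of 0]] s_le)
    moreover have "(snr M N \<longlongrightarrow> ereal L) at_top"
      by (rule Lim_transform_eventually[OF tendsto_ereal[OF L]])
         (rule eventually_mono[OF eventually_gt_at_top[of 0]], simp add: snr_s)
    ultimately show ?thesis by blast
  qed
  then obtain L where L: "(snr M N \<longlongrightarrow> ereal L) at_top" "L \<le> activity" by blast
  then have "asymptotic_snr M N = ereal L"
    unfolding asymptotic_snr_def by (intro tendsto_Lim) simp_all
  with L show ?thesis by simp
qed

text \<open>The activity is the \<open>p\<close>-average of the escape rates, with self-loops left
  out.\<close>

lemma activity_le:
  assumes "\<And>s. (\<Sum>s'\<in>UNIV. r s s') \<le> b"
  shows "activity \<le> b"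
proof -
  have "activity = (\<Sum>s\<in>UNIV. pmf p s * (\<Sum>s'\<in>UNIV. generator r s s' * of_bool (s \<noteq> s')))"
    unfolding activity_def flux_def influx_def sum_distrib_left by (rule sum.swap)
  also have "\<dots> \<le> (\<Sum>s\<in>UNIV. pmf p s * (\<Sum>s'\<in>UNIV. r s s'))"
    by (intro sum_mono mult_left_mono) (auto simp: generator_offdiag rate_nonneg)
  also have "\<dots> \<le> (\<Sum>s\<in>UNIV. pmf p s * b)"
    by (intro sum_mono mult_left_mono assms) simp
  also have "\<dots> = b" by (simp add: sum_distrib_right[symmetric] sum_pmf_eq_1)
  finally show ?thesis .
qed

end

section \<open>Application to clockworks under feedback\<close>

text \<open>The jump flips coordinate \<open>a\<close>, so it is visible as a change of state even
  if the memory stays as it was.\<close>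

lemma joint_jump_neq: "joint_jump pol a c \<noteq> c"
  by (cases c) (auto simp: joint_jump_def fun_eq_iff)

lemma sum_joint_rate: "(\<Sum>s'\<in>UNIV. joint_rate pol (x, m) s') = (\<Sum>a\<in>UNIV. clock_rate pol a (x a) m)"
  unfolding joint_rate_def prod.case by (subst sum.swap) simp

definition jump_type :: "('g, 'm) feedback_policy \<Rightarrow> 'g \<Rightarrow> bool \<Rightarrow> 'm
    \<Rightarrow> ('g \<Rightarrow> bool) \<times> 'm \<Rightarrow> ('g \<Rightarrow> bool) \<times> 'm \<Rightarrow> bool" where
  "jump_type pol a i m c d \<longleftrightarrow> fst c a = i \<and> snd c = m \<and> d = joint_jump pol a c"

lemma jump_times_eq: "jump_times pol \<xi> a i m t = transitions \<xi> (jump_type pol a i m) \<inter> {0<..t}"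
  by (fastforce simp: jump_times_def transitions_def jump_type_def)

theorem theorem2:
  fixes pol :: "('g::finite, 'm::finite) feedback_policy"
    and G :: "'g \<Rightarrow> real set"
    and p :: "(('g \<Rightarrow> bool) \<times> 'm) pmf"
    and M :: "'w measure"
    and X :: "real \<Rightarrow> 'w \<Rightarrow> ('g \<Rightarrow> bool) \<times> 'm"
    and w :: "'g \<Rightarrow> bool \<Rightarrow> 'm \<Rightarrow> real"
  assumes "\<And>a. G a \<noteq> {0}"
    and "\<And>a. G a \<subseteq> {0..}"
    and "\<And>a m. par_update pol a m \<in> G a \<times> G a"
    and "stationary (joint_rate pol) p"
    and "markov_jump_process M (joint_rate pol) p X"
  defines "N \<equiv> integrated_current pol X w"
  shows "(snr M N \<longlongrightarrow> asymptotic_snr M N) at_top \<and>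
         asymptotic_snr M N \<le>
           ereal (MAX m. MAX i :: 'g \<Rightarrow> bool. \<Sum>a\<in>UNIV. clock_rate pol a (i a) m)"
proof -
  interpret markov_jump_process M "joint_rate pol" p X by fact
  obtain P where P: "transition_function (joint_rate pol) P"
    and distr: "\<And>\<tau> s n. \<tau> 0 = 0 \<Longrightarrow> mono \<tau> \<Longrightarrow>
      measure M {\<omega> \<in> space M. \<forall>k\<le>n. X (\<tau> k) \<omega> = s k} =
             pmf p (s 0) * (\<Prod>k<n. P (\<tau> (Suc k) - \<tau> k) (s k) (s (Suc k)))"
    using finite_dim_distr by blast
  have "clock_rate pol a i m \<ge> 0" for a i m
    using assms(2)[of a] assms(3)[of a m] by (auto simp: clock_rate_def mem_Times_iff)
  then have rate: "joint_rate pol s s' \<ge> 0" for s s'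
    by (auto simp: joint_rate_def split: prod.split intro!: sum_nonneg)
  interpret stationary_jump_process M "joint_rate pol" p X P
    by unfold_locales (use rate P distr assms(4) in auto)
  \<comment> \<open>Rewrites the current as a weight on pairs of successive states, as the general
    bound expects; the diagonal vanishes since no jump type relates a state to itself.\<close>
  define W where "W c d = (\<Sum>a\<in>UNIV. \<Sum>i\<in>UNIV. \<Sum>m\<in>UNIV. w a i m * of_bool (jump_type pol a i m c d))" for c d
  have irr: "\<not> jump_type pol a i m c c" for a i m c
    using joint_jump_neq[of pol a c] by (auto simp: jump_type_def)
  have "(snr M N \<longlongrightarrow> asymptotic_snr M N) at_top \<and> asymptotic_snr M N \<le> ereal activity"
  proof (rule kinetic_uncertainty_relation)
    show "W s s = 0" for s by (simp add: W_def irr)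
    fix t \<omega> assume t: "(t :: real) > 0" and \<omega>: "\<omega> \<in> space M"
    \<comment> \<open>There are finitely many jump types and memory states, so one sufficiently fine
      mesh serves all of them at once.\<close>
    have "\<forall>\<^sub>F k in sequentially. \<forall>a i m.
        (\<Sum>j<k. of_bool (jump_type pol a i m (X (t * real j / real k) \<omega>) (X (t * real (Suc j) / real k) \<omega>)))
        = card (transitions (\<lambda>u. X u \<omega>) (jump_type pol a i m) \<inter> {0<..t})"
      by (intro eventually_all_finite card_transitions_eventually right_continuous left_limits \<omega> t irr)
    then show "\<forall>\<^sub>F k in sequentially. grid_sum W t k \<omega> = N t \<omega>"
    proof eventually_elim
      case (elim k)
      have "grid_sum W t k \<omega> = (\<Sum>a\<in>UNIV. \<Sum>i\<in>UNIV. \<Sum>m\<in>UNIV. w a i m * real (\<Sum>j<k.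
          of_bool (jump_type pol a i m (X (t * real j / real k) \<omega>) (X (t * real (Suc j) / real k) \<omega>))))"
        unfolding grid_sum_def W_def of_nat_sum of_nat_of_bool sum_distrib_left
        by (simp only: sum.swap[of _ "{..<k}"])
      also have "\<dots> = N t \<omega>"
        by (simp only: elim[rule_format] N_def integrated_current_def jump_times_eq)
      finally show ?case .
    qed
  qed
  moreover have "activity \<le> (MAX m. MAX i :: 'g \<Rightarrow> bool. \<Sum>a\<in>UNIV. clock_rate pol a (i a) m)"
  proof (rule activity_le)
    fix s :: "('g \<Rightarrow> bool) \<times> 'm"
    obtain x m where s: "s = (x, m)" by (cases s)
    \<comment> \<open>The clock configuration \<open>x\<close> is itself one of the assignments
      \<open>i\<close> over which the maximum runs.\<close>
    have "(\<Sum>s'\<in>UNIV. joint_rate pol s s') \<le> (MAX i :: 'g \<Rightarrow> bool. \<Sum>a\<in>UNIV. clock_rate pol a (i a) m)"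
      unfolding s sum_joint_rate by (rule Max_ge) auto
    also have "\<dots> \<le> (MAX m. MAX i :: 'g \<Rightarrow> bool. \<Sum>a\<in>UNIV. clock_rate pol a (i a) m)"
      by (rule Max_ge) auto
    finally show "(\<Sum>s'\<in>UNIV. joint_rate pol s s')
      \<le> (MAX m. MAX i :: 'g \<Rightarrow> bool. \<Sum>a\<in>UNIV. clock_rate pol a (i a) m)" .
  qed
  ultimately show ?thesis by (auto intro: order_trans)
qed

end
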